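(* Let $\mathsf{C}\subset V$ be a proper cone, $\phi$ in the interior of $\mathsf{C}^*$, $k\ge1$ an integer, and $K_\phi=\mathsf{C}\cap\phi^{-1}(1)$. The following are equivalent: (i) the $k$th reduction map $\gamma_k^\phi$ is entanglement-breaking; (ii) $K_\phi$ is affinely isomorphic to the Cartesian product of at most $k$ simplices.
   Context: A convex cone in a finite-dimensional real vector space is proper if it is closed, contains no line, and is not contained in any hyperplane; $\mathsf{C}^*=\{f\in V^*: f\ge0 \text{ on }\mathsf{C}\}$. Minimal tensor product: $\mathsf{C}_1\otimes_{\min}\mathsf{C}_2=\mathrm{conv}\{x\otimes y:x\in\mathsf{C}_1,y\in\mathsf{C}_2\}$, iterated as $\mathsf{C}^{\otimes_{\min}k}$. The $k$th reduction map $\gamma_k^\phi=\frac1k\sum_{j=1}^k \phi^{\otimes(j-1)}\otimes\mathrm{Id}_V\otimes\phi^{\otimes(k-j)}:V^{\otimes k}\to V$ is viewed as a tensor in $(V^* )^{\otimes k}\otimes V$ (identifying $(V^{\otimes k})^*$ with $(V^* )^{\otimes k}$), namely the unique tensor with $\langle\gamma_k^\phi, x_1\otimes\cdots\otimes x_k\otimes\psi\rangle=\frac{\psi(x_1)+\dots+\psi(x_k)}{k}$ for $x_i\in K_\phi$, $\psi\in V^*$. It is called entanglement-breaking if this tensor belongs to $(\mathsf{C}^* )^{\otimes_{\min}k}\otimes_{\min}\mathsf{C}$. *)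

theory Defs
  imports "HOL-Analysis.Analysis"
begin

text \<open>V is a Euclidean space; the dual V* is identified with V via the inner product,
  so a functional f acts as x \<mapsto> f \<bullet> x.\<close>

definition proper_cone :: "'a::euclidean_space set \<Rightarrow> bool" where
  "proper_cone C \<longleftrightarrow> convex C \<and> cone C \<and> closed C
     \<and> \<not> (\<exists>p v. v \<noteq> 0 \<and> (\<forall>t::real. p + t *\<^sub>R v \<in> C))
     \<and> (\<forall>a b. a \<noteq> 0 \<longrightarrow> \<not> C \<subseteq> {x. a \<bullet> x = b})"

definition dual_cone :: "'a::euclidean_space set \<Rightarrow> 'a set" where
  "dual_cone C = {f. \<forall>x\<in>C. 0 \<le> f \<bullet> x}"

text \<open>Tensors in (V*)^{\<otimes>k} \<otimes> V are represented as multilinear forms on V^k \<times> V*: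
  a tensor T is evaluated at (v 0, ..., v (k-1)) and \<psi> (the last argument, a functional).\<close>

type_synonym 'a tensor = "(nat \<Rightarrow> 'a) \<Rightarrow> 'a \<Rightarrow> real"

definition prod_tensor :: "nat \<Rightarrow> (nat \<Rightarrow> 'a::euclidean_space) \<Rightarrow> 'a \<Rightarrow> 'a tensor" where
  "prod_tensor k f x = (\<lambda>v \<psi>. (\<Prod>j<k. f j \<bullet> v j) * (\<psi> \<bullet> x))"

definition min_tensor_cone :: "'a::euclidean_space set \<Rightarrow> nat \<Rightarrow> 'a tensor set" where
  "min_tensor_cone C k = {T. \<exists>(n::nat) (c::nat \<Rightarrow> real) f x.
      (\<forall>i<n. 0 \<le> c i \<and> (\<forall>j<k. f i j \<in> dual_cone C) \<and> x i \<in> C)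
      \<and> (\<Sum>i<n. c i) = 1
      \<and> T = (\<lambda>v \<psi>. \<Sum>i<n. c i * prod_tensor k (f i) (x i) v \<psi>)}"

text \<open>The k-th reduction map (1/k) \<Sum>_j \<phi>^{\<otimes>(j-1)} \<otimes> Id \<otimes> \<phi>^{\<otimes>(k-j)} as a tensor.\<close>

definition reduction_tensor :: "nat \<Rightarrow> 'a::euclidean_space \<Rightarrow> 'a tensor" where
  "reduction_tensor k \<phi> = (\<lambda>v \<psi>. (1 / real k) *
      (\<Sum>j<k. (\<Prod>i\<in>{..<k} - {j}. \<phi> \<bullet> v i) * (\<psi> \<bullet> v j)))"

definition entanglement_breaking :: "'a::euclidean_space set \<Rightarrow> 'a \<Rightarrow> nat \<Rightarrow> bool" where
  "entanglement_breaking C \<phi> k \<longleftrightarrow> reduction_tensor k \<phi> \<in> min_tensor_cone C k"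

definition simplex_product :: "nat \<Rightarrow> (nat \<Rightarrow> nat) \<Rightarrow> (nat \<Rightarrow> nat \<Rightarrow> real) set" where
  "simplex_product m d = {p. (\<forall>i<m. (\<forall>j\<le>d i. 0 \<le> p i j) \<and> (\<Sum>j\<le>d i. p i j) = 1)
      \<and> (\<forall>i j. (m \<le> i \<or> d i < j) \<longrightarrow> p i j = 0)}"

definition affinely_isomorphic :: "'a::real_vector set \<Rightarrow> (nat \<Rightarrow> nat \<Rightarrow> real) set \<Rightarrow> bool" where
  "affinely_isomorphic K P \<longleftrightarrow> (\<exists>g. bij_betw g K P \<and>
      (\<forall>x\<in>K. \<forall>y\<in>K. \<forall>u::real. 0 \<le> u \<and> u \<le> 1 \<longrightarrow>
         g (u *\<^sub>R x + (1 - u) *\<^sub>R y) = (\<lambda>i j. u * g x i j + (1 - u) * g y i j)))"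

end

theory Submission
  imports Defs
begin

text \<open>
  Suppose \<open>\<gamma>\<close> is a sum of product terms \<open>f\<^sub>1 \<otimes> \<dots> \<otimes> f\<^sub>k \<otimes> x\<close>. Evaluating it on vectors of a facet shows
  that for every facet not containing \<open>x\<close> one of the factors \<open>f\<^sub>j\<close> is proportional to the functional
  of that facet; in particular a vertex \<open>w\<close> of \<open>K\<close> misses at most \<open>k\<close> facets. Evaluating \<open>\<gamma>\<close> at \<open>w\<close> in
  all slots but one shows that the facets through \<open>w\<close> are linearly independent, so \<open>w\<close> is a simple
  vertex. If a facet \<open>h\<close> misses an edge at \<open>w\<close>, evaluating \<open>\<gamma>\<close> at the vector of the plane of the edge
  annihilated by \<open>h\<close> shows that \<open>h\<close> is proportional to \<open>\<phi>\<close> on the edge. The far end of each edge at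
  \<open>w\<close> lies on exactly one facet missing \<open>w\<close>, and grouping the edges accordingly yields, for each facet
  \<open>h\<close> missing \<open>w\<close>, a relation expressing \<open>\<phi>\<close> as \<open>h\<close> plus the facets through \<open>w\<close> of its group (suitably
  scaled). These relations say that \<open>K\<close> is a product of simplices, one for each facet missing \<open>w\<close>.

  Conversely, if \<open>K\<close> is a product of at most \<open>k\<close> simplices, the average of \<open>k\<close> points is obtained by
  measuring each simplex factor on a different copy, averaged over the rows of a Latin square
  assigning factors to copies.
\<close>

section \<open>Cones and their duals\<close>

lemma dual_coneD: "f \<in> dual_cone C \<Longrightarrow> x \<in> C \<Longrightarrow> 0 \<le> f \<bullet> x"
  by (simp add: dual_cone_def)

lemma cone_dual_cone: "cone (dual_cone C)"
  by (auto simp: cone_def dual_cone_def)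

lemma convex_dual_cone: "convex (dual_cone C)"
  by (auto simp: convex_def dual_cone_def inner_add_left)

lemma closed_dual_cone: "closed (dual_cone C)"
proof -
  have "dual_cone C = (\<Inter>x\<in>C. {f. 0 \<le> x \<bullet> f})"
    by (auto simp: dual_cone_def inner_commute)
  then show ?thesis
    by (simp add: closed_INT closed_halfspace_ge[of 0, simplified])
qed

lemma subset_dual_dual_cone: "C \<subseteq> dual_cone (dual_cone C)"
  by (auto simp: dual_cone_def inner_commute)

lemma cone_add:
  assumes "convex C" "cone C" "x \<in> C" "y \<in> C"
  shows "x + y \<in> C"
  using assms convex_cone by blast

lemma cone_scaleR: "cone C \<Longrightarrow> x \<in> C \<Longrightarrow> 0 \<le> c \<Longrightarrow> c *\<^sub>R x \<in> C"
  by (simp add: cone_def)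

text \<open>\<open>\<phi>\<close> stays in the dual cone after subtracting a small multiple of the
  unit vector along \<open>x\<close>; evaluating the difference at \<open>x\<close> gives the
  bound.\<close>

lemma interior_dual_cone_bound:
  fixes C :: "'a::euclidean_space set"
  assumes "\<phi> \<in> interior (dual_cone C)"
  obtains \<delta> where "\<delta> > 0" "\<And>x. x \<in> C \<Longrightarrow> \<delta> * norm x \<le> \<phi> \<bullet> x"
proof -
  obtain e where e: "e > 0" "cball \<phi> e \<subseteq> dual_cone C"
    using assms mem_interior_cball by blast
  have "e * norm x \<le> \<phi> \<bullet> x" if "x \<in> C" for x
  proof (cases "x = 0")
    case False
    have "\<phi> - (e / norm x) *\<^sub>R x \<in> dual_cone C"
      using e False by (intro subsetD[OF e(2)]) (simp add: dist_norm)
    then have "0 \<le> (\<phi> - (e / norm x) *\<^sub>R x) \<bullet> x"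
      using that dual_coneD by blast
    also have "\<dots> = \<phi> \<bullet> x - e * norm x"
      using False by (simp add: inner_diff_left power2_norm_eq_inner[symmetric] power2_eq_square)
    finally show ?thesis by simp
  qed simp
  then show ?thesis using that e(1) by blast
qed

lemma interior_dual_cone_pos:
  fixes C :: "'a::euclidean_space set"
  assumes "\<phi> \<in> interior (dual_cone C)" "x \<in> C" "x \<noteq> 0"
  shows "0 < \<phi> \<bullet> x"
  using interior_dual_cone_bound[OF assms(1)] assms(2,3)
  by (metis less_le_trans mult_pos_pos zero_less_norm_iff)

lemma compact_cone_base:
  fixes C :: "'a::euclidean_space set"
  assumes "closed C" "\<phi> \<in> interior (dual_cone C)"
  shows "compact (C \<inter> {x. \<phi> \<bullet> x = 1})"
proof -
  obtain \<delta> where d: "\<delta> > 0" "\<And>x. x \<in> C \<Longrightarrow> \<delta> * norm x \<le> \<phi> \<bullet> x"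
    using interior_dual_cone_bound[OF assms(2)] by blast
  have "norm x \<le> 1 / \<delta>" if "x \<in> C \<inter> {x. \<phi> \<bullet> x = 1}" for x
    using d(2)[of x] that d(1) by (simp add: field_simps)
  then have "bounded (C \<inter> {x. \<phi> \<bullet> x = 1})"
    using boundedI by blast
  then show ?thesis
    using assms(1) by (simp add: compact_eq_bounded_closed closed_Int closed_hyperplane)
qed

text \<open>Scaling \<open>p\<close> and \<open>q\<close> to \<open>a\<close>-value 1 exhibits
  \<open>e\<close> as a convex combination of two points of the base. It serves both for
  \<open>C\<close> with \<open>\<phi>\<close> and for the dual cone with an interior point of
  \<open>C\<close>.\<close>

lemma extreme_point_cone_base:
  fixes C :: "'a::euclidean_space set"
  assumes "cone C" and pos: "\<And>x. x \<in> C \<Longrightarrow> x \<noteq> 0 \<Longrightarrow> 0 < a \<bullet> x"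
    and e: "e extreme_point_of (C \<inter> {x. a \<bullet> x = 1})"
    and p: "p \<in> C" and q: "q \<in> C" and pq: "p + q = e"
  shows "p = (a \<bullet> p) *\<^sub>R e"
proof (cases "p = 0 \<or> q = 0")
  case True
  then show ?thesis using e pq by (auto simp: extreme_point_of_def)
next
  case False
  let ?s = "a \<bullet> p" and ?t = "a \<bullet> q"
  have st: "?s > 0" "?t > 0" using False pos p q by auto
  have "a \<bullet> e = 1" using e by (auto simp: extreme_point_of_def)
  then have sum: "?s + ?t = 1" using pq by (auto simp: inner_add_right)
  define p' q' where "p' = (1 / ?s) *\<^sub>R p" and "q' = (1 / ?t) *\<^sub>R q"
  have mem: "p' \<in> C \<inter> {x. a \<bullet> x = 1}" "q' \<in> C \<inter> {x. a \<bullet> x = 1}"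
    using st p q \<open>cone C\<close> by (auto simp: p'_def q'_def cone_def)
  have eq: "e = ?s *\<^sub>R p' + ?t *\<^sub>R q'" using st pq by (simp add: p'_def q'_def)
  have "p' = e"
  proof (rule ccontr)
    assume ne: "p' \<noteq> e"
    have "p' \<noteq> q'"
    proof
      assume "p' = q'"
      then have "e = p'" using eq sum by (metis scaleR_add_left scaleR_one)
      then show False using ne by simp
    qed
    moreover have "?s = 1 - ?t" using sum by simp
    then have "e = (1 - ?t) *\<^sub>R p' + ?t *\<^sub>R q'" using eq by simp
    ultimately have "e \<in> open_segment p' q'"
      using st sum by (auto simp: in_segment intro!: exI[of _ ?t])
    then show False using e mem unfolding extreme_point_of_def by blast
  qed
  then show ?thesis using st by (auto simp: p'_def)
qed

lemma dual_cone_separation: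
  fixes C :: "'a::euclidean_space set"
  assumes "convex C" "cone C" "closed C" "C \<noteq> {}" "y \<notin> C"
  obtains f where "f \<in> dual_cone C" "f \<bullet> y < 0"
proof -
  obtain a b where ab: "a \<bullet> y < b" "\<And>x. x \<in> C \<Longrightarrow> b < a \<bullet> x"
    using separating_hyperplane_closed_point[OF assms(1,3,5)] by blast
  have "0 \<in> C" using assms cone_0 cone_contains_0 by blast
  then have "b < 0" using ab(2)[of 0] by simp
  have "0 \<le> a \<bullet> x" if "x \<in> C" for x
  proof (rule ccontr)
    assume "\<not> 0 \<le> a \<bullet> x"
    then have neg: "a \<bullet> x < 0" by simp
    then have "(b / (a \<bullet> x)) *\<^sub>R x \<in> C"
      using \<open>b < 0\<close> that assms(2) by (intro cone_scaleR) (auto simp: divide_nonpos_nonpos)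
    then have "b < a \<bullet> ((b / (a \<bullet> x)) *\<^sub>R x)" using ab(2) by blast
    then show False using neg by simp
  qed
  then show ?thesis using that[of a] ab \<open>b < 0\<close> by (auto simp: dual_cone_def)
qed

lemma proper_cone_interior:
  fixes C :: "'a::euclidean_space set"
  assumes "proper_cone C"
  obtains u where "u \<in> interior C"
proof -
  have "interior C \<noteq> {}"
  proof
    assume "interior C = {}"
    then obtain a b where "a \<noteq> 0" "C \<subseteq> {x. a \<bullet> x = b}"
      using empty_interior_subset_hyperplane[of C] assms by (auto simp: proper_cone_def)
    then show False using assms by (auto simp: proper_cone_def)
  qed
  then show ?thesis using that by blast
qed

section \<open>Facets and edges at a vertex\<close>

text \<open>Allows a small multiple of one functional or vector to be subtracted from another while
  finitely many nonnegativity tests survive.\<close>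

lemma finite_positive_scale:
  fixes a b :: "'i \<Rightarrow> real"
  assumes "finite S" "\<And>i. i \<in> S \<Longrightarrow> 0 \<le> a i" "\<And>i. i \<in> S \<Longrightarrow> 0 \<le> b i"
    "\<And>i. i \<in> S \<Longrightarrow> a i = 0 \<Longrightarrow> b i = 0"
  obtains \<epsilon> where "\<epsilon> > 0" "\<And>i. i \<in> S \<Longrightarrow> \<epsilon> * b i \<le> a i"
proof -
  have "\<exists>\<epsilon>>0. \<forall>i\<in>S. \<epsilon> * b i \<le> a i"
    using assms
  proof (induction S rule: finite_induct)
    case empty
    then show ?case by (auto intro: exI[of _ 1])
  next
    case (insert s S)
    then obtain \<epsilon> where e: "\<epsilon> > 0" "\<forall>i\<in>S. \<epsilon> * b i \<le> a i" by auto
    obtain \<eta> where h: "\<eta> > 0" "\<eta> * b s \<le> a s"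
    proof (cases "b s = 0")
      case True
      then show ?thesis using that[of 1] insert.prems(1) by simp
    next
      case False
      then have "b s > 0" "a s > 0"
        using insert.prems(1,2,3)[of s] by force+
      then show ?thesis using that[of "a s / b s"] by simp
    qed
    have "min \<epsilon> \<eta> * b i \<le> a i" if "i \<in> insert s S" for i
    proof -
      have "0 \<le> b i" using insert.prems(2) that by blast
      then have "min \<epsilon> \<eta> * b i \<le> \<epsilon> * b i" "min \<epsilon> \<eta> * b i \<le> \<eta> * b i"
        by (auto intro: mult_right_mono)
      then show ?thesis using that e h by force
    qed
    then show ?case using e(1) h(1) by (intro exI[of _ "min \<epsilon> \<eta>"]) auto
  qed
  then show ?thesis using that by blast
qed

text \<open>For fixed \<open>l\<close> the functionals \<open>q l j\<close> act as barycentric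
  coordinates of the \<open>l\<close>-th simplex. \<open>C_memI\<close> says that they cut out the
  cone, \<open>sep\<close> gives injectivity, and \<open>surj\<close> says that the factors can be
  prescribed independently.\<close>

lemma affinely_isomorphic_simplex_product:
  fixes C :: "'a::euclidean_space set" and q :: "nat \<Rightarrow> nat \<Rightarrow> 'a"
  assumes sum_q: "\<And>l. l < m \<Longrightarrow> (\<Sum>j\<le>d l. q l j) = \<phi>"
    and q_dual: "\<And>l j. l < m \<Longrightarrow> j \<le> d l \<Longrightarrow> q l j \<in> dual_cone C"
    and C_memI: "\<And>y. (\<And>l j. l < m \<Longrightarrow> j \<le> d l \<Longrightarrow> 0 \<le> q l j \<bullet> y) \<Longrightarrow> y \<in> C"
    and sep: "\<And>y. (\<And>l j. l < m \<Longrightarrow> j \<le> d l \<Longrightarrow> q l j \<bullet> y = 0) \<Longrightarrow> y = 0"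
    and surj: "\<And>p. p \<in> simplex_product m d \<Longrightarrow>
      \<exists>y. \<phi> \<bullet> y = 1 \<and> (\<forall>l<m. \<forall>j\<le>d l. q l j \<bullet> y = p l j)"
  shows "affinely_isomorphic (C \<inter> {x. \<phi> \<bullet> x = 1}) (simplex_product m d)"
proof -
  define g where "g y = (\<lambda>l j. if l < m \<and> j \<le> d l then q l j \<bullet> y else 0)" for y
  let ?K = "C \<inter> {x. \<phi> \<bullet> x = 1}"
  have "inj_on g ?K"
  proof (rule inj_onI)
    fix y y' assume "g y = g y'"
    then have "q l j \<bullet> (y - y') = 0" if "l < m" "j \<le> d l" for l j
      using that by (auto simp: g_def fun_eq_iff inner_diff_right split: if_splits)
    then show "y = y'" using sep[of "y - y'"] by simp
  qed
  moreover have "g y \<in> simplex_product m d" if "y \<in> ?K" for y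
  proof -
    have "(\<Sum>j\<le>d l. g y l j) = 1" if "l < m" for l
    proof -
      have "(\<Sum>j\<le>d l. g y l j) = (\<Sum>j\<le>d l. q l j) \<bullet> y"
        using that by (simp add: g_def inner_sum_left)
      then show ?thesis using sum_q[OF that] \<open>y \<in> ?K\<close> by simp
    qed
    then show ?thesis
      using that q_dual by (auto simp: simplex_product_def g_def dual_cone_def)
  qed
  moreover have "p \<in> g ` ?K" if p: "p \<in> simplex_product m d" for p
  proof -
    obtain y where y: "\<phi> \<bullet> y = 1" "\<forall>l<m. \<forall>j\<le>d l. q l j \<bullet> y = p l j" using surj[OF p] by blast
    have "y \<in> C" using C_memI[of y] y p by (simp add: simplex_product_def)
    moreover have "g y = p"
      using y p by (auto simp: g_def simplex_product_def fun_eq_iff not_less not_le)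
    ultimately show ?thesis using y by blast
  qed
  ultimately have "bij_betw g ?K (simplex_product m d)" by (auto simp: bij_betw_def)
  moreover have "g (t *\<^sub>R x + (1 - t) *\<^sub>R y) = (\<lambda>i j. t * g x i j + (1 - t) * g y i j)" for t x y
    by (auto simp: g_def fun_eq_iff inner_add_right)
  ultimately show ?thesis unfolding affinely_isomorphic_def by blast
qed

text \<open>Convex weights are absorbed into the vectors \<open>x i\<close>. The point
  \<open>u\<close> normalises functionals, giving the dual cone a compact base; \<open>w\<close> is
  the vertex at which the product structure is read off.\<close>

locale reduction_decomposition =
  fixes C :: "'a::euclidean_space set" and \<phi> :: 'a and k n :: nat
    and f :: "nat \<Rightarrow> nat \<Rightarrow> 'a" and x :: "nat \<Rightarrow> 'a" and u w :: 'a
  assumes proper: "proper_cone C"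
    and phi: "\<phi> \<in> interior (dual_cone C)"
    and k_pos: "1 \<le> k"
    and f_dual: "\<And>i j. i < n \<Longrightarrow> j < k \<Longrightarrow> f i j \<in> dual_cone C"
    and x_mem: "\<And>i. i < n \<Longrightarrow> x i \<in> C"
    and decomp: "\<And>v \<psi>. (1 / real k) * (\<Sum>j<k. (\<Prod>i\<in>{..<k} - {j}. \<phi> \<bullet> v i) * (\<psi> \<bullet> v j))
      = (\<Sum>i<n. (\<Prod>j<k. f i j \<bullet> v j) * (\<psi> \<bullet> x i))"
    and u: "u \<in> interior C"
    and w: "w extreme_point_of (C \<inter> {x. \<phi> \<bullet> x = 1})"
begin

lemma cone_C: "convex C" "cone C" "closed C"
  using proper by (auto simp: proper_cone_def)

lemma u_mem: "u \<in> C"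
  using u interior_subset by blast

lemma phi_pos: "y \<in> C \<Longrightarrow> y \<noteq> 0 \<Longrightarrow> 0 < \<phi> \<bullet> y"
  using interior_dual_cone_pos phi by blast

lemma u_interior_dual: "u \<in> interior (dual_cone (dual_cone C))"
  using u interior_mono[OF subset_dual_dual_cone] by blast

lemma u_pos: "g \<in> dual_cone C \<Longrightarrow> g \<noteq> 0 \<Longrightarrow> 0 < u \<bullet> g"
  using interior_dual_cone_pos u_interior_dual by blast

lemma w_mem: "w \<in> C" and phi_w: "\<phi> \<bullet> w = 1"
  using w by (auto simp: extreme_point_of_def)

lemma w_extreme: "p \<in> C \<Longrightarrow> q \<in> C \<Longrightarrow> p + q = w \<Longrightarrow> p = (\<phi> \<bullet> p) *\<^sub>R w"
  using extreme_point_cone_base[OF cone_C(2) phi_pos w] by blast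

section \<open>Evaluations of the decomposition\<close>

lemma decomp_diag:
  "(\<phi> \<bullet> y) ^ (k - 1) * (\<psi> \<bullet> y) = (\<Sum>i<n. (\<Prod>j<k. f i j \<bullet> y) * (\<psi> \<bullet> x i))"
proof -
  have "(1 / real k) * (\<Sum>j<k. (\<Prod>i\<in>{..<k} - {j}. \<phi> \<bullet> y) * (\<psi> \<bullet> y))
      = (\<phi> \<bullet> y) ^ (k - 1) * (\<psi> \<bullet> y)"
    using k_pos by simp
  then show ?thesis using decomp[of "\<lambda>_. y" \<psi>] by simp
qed

lemma lessThan_k: "{..<k} = insert 0 {1..<k}"
  using k_pos by auto

text \<open>\<open>y\<close> is put into slot 0 and \<open>a\<close> into all others. The term
  \<open>j = 0\<close> of the reduction map contributes \<open>\<psi> \<bullet> y\<close>; each of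
  the other \<open>k - 1\<close> terms retains one factor \<open>\<phi> \<bullet> y\<close>.\<close>

lemma decomp_slot:
  assumes a: "\<phi> \<bullet> a = 1"
  shows "\<psi> \<bullet> y + real (k - 1) * ((\<phi> \<bullet> y) * (\<psi> \<bullet> a))
    = real k * (\<Sum>i<n. (f i 0 \<bullet> y) * (\<Prod>j\<in>{1..<k}. f i j \<bullet> a) * (\<psi> \<bullet> x i))"
proof -
  define v where "v j = (if j = (0::nat) then y else a)" for j
  have v: "v 0 = y" "\<And>j. j \<in> {1..<k} \<Longrightarrow> v j = a" by (auto simp: v_def)
  have p0: "(\<Prod>i\<in>{..<k} - {0}. \<phi> \<bullet> v i) = 1"
    using a by (intro prod.neutral) (auto simp: v_def)
  have pj: "(\<Prod>i\<in>{..<k} - {j}. \<phi> \<bullet> v i) = \<phi> \<bullet> y" if "j \<in> {1..<k}" for j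
  proof -
    have "{..<k} - {j} = insert 0 ({1..<k} - {j})" using that k_pos by auto
    then have "(\<Prod>i\<in>{..<k} - {j}. \<phi> \<bullet> v i) = (\<phi> \<bullet> v 0) * (\<Prod>i\<in>{1..<k} - {j}. \<phi> \<bullet> v i)"
      by simp
    also have "(\<Prod>i\<in>{1..<k} - {j}. \<phi> \<bullet> v i) = 1"
      using a by (intro prod.neutral) (auto simp: v_def)
    finally show ?thesis by (simp add: v)
  qed
  have "(\<Sum>j<k. (\<Prod>i\<in>{..<k} - {j}. \<phi> \<bullet> v i) * (\<psi> \<bullet> v j))
      = \<psi> \<bullet> y + (\<Sum>j\<in>{1..<k}. (\<Prod>i\<in>{..<k} - {j}. \<phi> \<bullet> v i) * (\<psi> \<bullet> v j))"
    by (subst (2) lessThan_k) (simp add: p0 v(1))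
  also have "(\<Sum>j\<in>{1..<k}. (\<Prod>i\<in>{..<k} - {j}. \<phi> \<bullet> v i) * (\<psi> \<bullet> v j))
      = (\<Sum>j\<in>{1..<k}. (\<phi> \<bullet> y) * (\<psi> \<bullet> a))"
    by (intro sum.cong) (simp_all only: pj v)
  also have "\<dots> = real (k - 1) * ((\<phi> \<bullet> y) * (\<psi> \<bullet> a))" by simp
  finally have L: "(\<Sum>j<k. (\<Prod>i\<in>{..<k} - {j}. \<phi> \<bullet> v i) * (\<psi> \<bullet> v j))
      = \<psi> \<bullet> y + real (k - 1) * ((\<phi> \<bullet> y) * (\<psi> \<bullet> a))" .
  have "(\<Prod>j<k. f i j \<bullet> v j) = (f i 0 \<bullet> y) * (\<Prod>j\<in>{1..<k}. f i j \<bullet> a)" for i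
    by (subst lessThan_k) (simp add: v)
  then have "(1 / real k) * (\<psi> \<bullet> y + real (k - 1) * ((\<phi> \<bullet> y) * (\<psi> \<bullet> a)))
    = (\<Sum>i<n. (f i 0 \<bullet> y) * (\<Prod>j\<in>{1..<k}. f i j \<bullet> a) * (\<psi> \<bullet> x i))"
    using decomp[of v \<psi>] unfolding L by simp
  then show ?thesis using k_pos by (simp add: field_simps)
qed

section \<open>Facets as extreme rays of the dual cone\<close>

text \<open>A facet is represented by its functional, scaled to value 1 at \<open>u\<close>.
  Polyhedrality is not presupposed; finiteness comes out of the decomposition in
  \<open>finite_facets\<close>.\<close>

definition facets :: "'a set" where
  "facets = {h. h extreme_point_of (dual_cone C \<inter> {h. u \<bullet> h = 1})}"

lemma facet_dual: "h \<in> facets \<Longrightarrow> h \<in> dual_cone C" and facet_u: "h \<in> facets \<Longrightarrow> u \<bullet> h = 1"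
  by (auto simp: facets_def extreme_point_of_def)

lemma facet_nonneg: "h \<in> facets \<Longrightarrow> y \<in> C \<Longrightarrow> 0 \<le> h \<bullet> y"
  using facet_dual dual_coneD by blast

lemma prod_nonneg_C:
  "i < n \<Longrightarrow> (\<And>j. j < k \<Longrightarrow> v j \<in> C) \<Longrightarrow> 0 \<le> (\<Prod>j<k. f i j \<bullet> v j)"
  by (intro prod_nonneg ballI dual_coneD[OF f_dual]) auto

text \<open>For a general cone, vanishing on the zero set of an extreme functional does not force
  proportionality to it. Here the \<open>x i\<close> generate \<open>C\<close> by
  \<open>decomp_diag\<close>, so membership in the dual cone is tested at finitely many points;
  hence \<open>h\<close> minus a small multiple of \<open>g\<close> is still in it, and extremality
  of \<open>h\<close> applies.\<close>

lemma facet_extremal: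
  assumes h: "h \<in> facets" and g: "g \<in> dual_cone C"
    and van: "\<And>y. y \<in> C \<Longrightarrow> h \<bullet> y = 0 \<Longrightarrow> g \<bullet> y = 0"
  shows "g = (u \<bullet> g) *\<^sub>R h"
proof -
  obtain \<epsilon> where e: "\<epsilon> > 0" "\<And>i. i \<in> {..<n} \<Longrightarrow> \<epsilon> * (g \<bullet> x i) \<le> h \<bullet> x i"
    using finite_positive_scale[of "{..<n}" "\<lambda>i. h \<bullet> x i" "\<lambda>i. g \<bullet> x i"]
      facet_nonneg[OF h x_mem] dual_coneD[OF g x_mem] van x_mem by auto
  have "h - \<epsilon> *\<^sub>R g \<in> dual_cone C"
    unfolding dual_cone_def
  proof (intro CollectI ballI)
    fix y assume y: "y \<in> C"
    show "0 \<le> (h - \<epsilon> *\<^sub>R g) \<bullet> y"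
    proof (cases "y = 0")
      case False
      have "0 \<le> (\<Sum>i<n. (\<Prod>j<k. f i j \<bullet> y) * ((h - \<epsilon> *\<^sub>R g) \<bullet> x i))"
        using e y by (intro sum_nonneg mult_nonneg_nonneg prod_nonneg_C)
          (auto simp: inner_diff_left)
      then have "0 \<le> (\<phi> \<bullet> y) ^ (k - 1) * ((h - \<epsilon> *\<^sub>R g) \<bullet> y)"
        using decomp_diag by simp
      then show ?thesis
        using zero_less_power[OF phi_pos[OF y False], of "k - 1"] by (simp add: zero_le_mult_iff)
    qed simp
  qed
  then have "\<epsilon> *\<^sub>R g = (u \<bullet> (\<epsilon> *\<^sub>R g)) *\<^sub>R h"
    using extreme_point_cone_base[OF cone_dual_cone u_pos, where e = h and p = "\<epsilon> *\<^sub>R g" and q = "h - \<epsilon> *\<^sub>R g"] h e(1)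
      cone_scaleR[OF cone_dual_cone g] by (simp add: facets_def)
  then have "\<epsilon> *\<^sub>R g = \<epsilon> *\<^sub>R ((u \<bullet> g) *\<^sub>R h)" by simp
  then show ?thesis using e(1) scaleR_left_imp_eq[of \<epsilon>] by blast
qed

text \<open>Otherwise \<open>facet_extremal\<close> provides for each slot a vector of
  \<open>C\<close> on which \<open>h\<close> vanishes but \<open>f i j\<close> does not. With these
  arguments and \<open>\<psi> = h\<close> the reduction map gives 0, whereas the decomposition is a
  sum of nonnegative terms whose \<open>i\<close>-th term is nonzero.\<close>

lemma facet_in_slot:
  assumes i: "i < n" and h: "h \<in> facets" and nz: "h \<bullet> x i \<noteq> 0"
  obtains j where "j < k" "f i j = (u \<bullet> f i j) *\<^sub>R h"
proof -
  have "\<exists>j<k. f i j = (u \<bullet> f i j) *\<^sub>R h"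
  proof (rule ccontr)
    assume no: "\<not> ?thesis"
    have "\<exists>y. y \<in> C \<and> h \<bullet> y = 0 \<and> f i j \<bullet> y \<noteq> 0" if "j < k" for j
      using facet_extremal[OF h f_dual[OF i that]] no that by blast
    then obtain v where v: "\<And>j. j < k \<Longrightarrow> v j \<in> C \<and> h \<bullet> v j = 0 \<and> f i j \<bullet> v j \<noteq> 0"
      by metis
    have "(\<Sum>i<n. (\<Prod>j<k. f i j \<bullet> v j) * (h \<bullet> x i)) = 0"
      unfolding decomp[symmetric] using v by simp
    moreover have "\<And>i. i < n \<Longrightarrow> 0 \<le> (\<Prod>j<k. f i j \<bullet> v j) * (h \<bullet> x i)"
      using v prod_nonneg_C facet_nonneg[OF h x_mem] by simp
    ultimately have "(\<Prod>j<k. f i j \<bullet> v j) * (h \<bullet> x i) = 0"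
      using i by (subst (asm) sum_nonneg_eq_0_iff) auto
    then show False using nz v by auto
  qed
  then show ?thesis using that by blast
qed

text \<open>A point outside \<open>C\<close> is separated by a functional which, after scaling, lies
  in the compact base of the dual cone; by Krein-Milman this base is the convex hull of
  \<open>facets\<close>.\<close>

lemma facets_detect:
  assumes "\<And>h. h \<in> facets \<Longrightarrow> 0 \<le> h \<bullet> y"
  shows "y \<in> C"
proof (rule ccontr)
  assume "y \<notin> C"
  then obtain g where g: "g \<in> dual_cone C" "g \<bullet> y < 0"
    using dual_cone_separation[OF cone_C] u_mem by blast
  let ?B = "dual_cone C \<inter> {h. u \<bullet> h = 1}"
  have "convex ?B" by (intro convex_Int convex_dual_cone convex_hyperplane)
  then have hull: "?B = convex hull facets"
    using Krein_Milman_Minkowski compact_cone_base[OF closed_dual_cone u_interior_dual]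
    unfolding facets_def by blast
  have "g \<noteq> 0" using g by auto
  then have ug: "u \<bullet> g > 0" using g u_pos by blast
  then have "(1 / (u \<bullet> g)) *\<^sub>R g \<in> ?B"
    using g cone_scaleR[OF cone_dual_cone g(1), of "1 / (u \<bullet> g)"] by auto
  moreover have "convex hull facets \<subseteq> {h. 0 \<le> y \<bullet> h}"
    using assms by (intro hull_minimal convex_halfspace_ge)
      (auto simp: inner_commute)
  ultimately have "0 \<le> y \<bullet> ((1 / (u \<bullet> g)) *\<^sub>R g)" using hull by blast
  then show False using g ug by (simp add: inner_commute zero_le_divide_iff)
qed

text \<open>Since \<open>h \<bullet> u = 1\<close>, evaluating the decomposition at \<open>u\<close>
  with \<open>\<psi> = h\<close> leaves a nonzero term, so \<open>h\<close> is a rescaled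
  \<open>f i j\<close>.\<close>

lemma finite_facets: "finite facets"
proof (rule finite_subset)
  show "facets \<subseteq> (\<lambda>(i, j). (1 / (u \<bullet> f i j)) *\<^sub>R f i j) ` ({..<n} \<times> {..<k})"
  proof
    fix h assume h: "h \<in> facets"
    have "u \<noteq> 0" using facet_u[OF h] by auto
    then have nz: "(\<phi> \<bullet> u) ^ (k - 1) * (h \<bullet> u) \<noteq> 0"
      using phi_pos[OF u_mem] facet_u[OF h] by (simp add: inner_commute)
    have "\<exists>i j. i < n \<and> j < k \<and> f i j = (u \<bullet> f i j) *\<^sub>R h \<and> f i j \<noteq> 0"
    proof (rule ccontr)
      assume no: "\<not> ?thesis"
      have "(\<Prod>j<k. f i j \<bullet> u) * (h \<bullet> x i) = 0" if i: "i < n" for i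
      proof (cases "h \<bullet> x i = 0")
        case False
        then obtain j where "j < k" "f i j = (u \<bullet> f i j) *\<^sub>R h" using facet_in_slot[OF i h] by blast
        then show ?thesis using no i by force
      qed simp
      then have "(\<Sum>i<n. (\<Prod>j<k. f i j \<bullet> u) * (h \<bullet> x i)) = 0" by (intro sum.neutral) simp
      then show False using nz unfolding decomp_diag by blast
    qed
    then obtain i j where ij: "i < n" "j < k" "f i j = (u \<bullet> f i j) *\<^sub>R h" "f i j \<noteq> 0" by blast
    have "u \<bullet> f i j \<noteq> 0" using u_pos[OF f_dual[OF ij(1,2)] ij(4)] by simp
    then have "h = (1 / (u \<bullet> f i j)) *\<^sub>R f i j"
      by (subst (2) ij(3)) simp
    then show "h \<in> (\<lambda>(i, j). (1 / (u \<bullet> f i j)) *\<^sub>R f i j) ` ({..<n} \<times> {..<k})"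
      using ij by force
  qed
qed simp

section \<open>Facets through and off the vertex\<close>

definition facets_at :: "'a set" where
  "facets_at = {h \<in> facets. h \<bullet> w = 0}"

definition facets_off :: "'a set" where
  "facets_off = {h \<in> facets. 0 < h \<bullet> w}"

lemma facet_cases: "h \<in> facets \<Longrightarrow> h \<in> facets_at \<or> h \<in> facets_off"
  using facet_nonneg[OF _ w_mem] by (force simp: facets_at_def facets_off_def)

lemma facets_atD: "b \<in> facets_at \<Longrightarrow> b \<in> facets" "b \<in> facets_at \<Longrightarrow> b \<bullet> w = 0"
  by (auto simp: facets_at_def)

lemma facets_offD: "h \<in> facets_off \<Longrightarrow> h \<in> facets" "h \<in> facets_off \<Longrightarrow> 0 < h \<bullet> w"
  by (auto simp: facets_off_def)

lemma facets_off_nonempty: "facets_off \<noteq> {}"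
proof
  assume "facets_off = {}"
  then have "- w \<in> C"
    by (intro facets_detect) (use facet_cases facets_atD(2) in force)
  moreover have "w \<noteq> 0" using phi_w by auto
  ultimately show False using phi_pos[of "- w"] phi_w by simp
qed

lemma facet_slot_unique:
  assumes "h \<in> facets" "h' \<in> facets" "g = (u \<bullet> g) *\<^sub>R h" "g = (u \<bullet> g) *\<^sub>R h'" "g \<noteq> 0"
  shows "h = h'"
proof -
  have "u \<bullet> g \<noteq> 0" using assms(3,5) by auto
  moreover have "(u \<bullet> g) *\<^sub>R h = (u \<bullet> g) *\<^sub>R h'" using assms(3,4) by metis
  ultimately show ?thesis using scaleR_left_imp_eq by blast
qed

text \<open>With \<open>w\<close> in all slots, the decomposition writes \<open>w\<close> as a
  nonnegative combination of the \<open>x i\<close>. Extremality of \<open>w\<close> puts every term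
  with nonzero coefficient on its ray.\<close>

lemma x_parallel_w:
  assumes i: "i < n" and nz: "\<And>j. j < k \<Longrightarrow> f i j \<bullet> w \<noteq> 0"
  shows "x i = (\<phi> \<bullet> x i) *\<^sub>R w"
proof -
  define a where "a i = (\<Prod>j<k. f i j \<bullet> w)" for i
  have a0: "0 \<le> a i" if "i < n" for i
    unfolding a_def using that w_mem by (intro prod_nonneg_C) auto
  have "\<psi> \<bullet> w = \<psi> \<bullet> (\<Sum>i<n. a i *\<^sub>R x i)" for \<psi>
    using decomp_diag[of w \<psi>] phi_w by (simp add: inner_sum_right a_def)
  then have "w = (\<Sum>i<n. a i *\<^sub>R x i)" using vector_eq_ldot by blast
  also have "\<dots> = a i *\<^sub>R x i + (\<Sum>i'\<in>{..<n} - {i}. a i' *\<^sub>R x i')"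
    using i by (simp add: sum.remove)
  finally have eq: "a i *\<^sub>R x i + (\<Sum>i'\<in>{..<n} - {i}. a i' *\<^sub>R x i') = w" ..
  have "0 \<in> C" using cone_scaleR[OF cone_C(2) u_mem, of 0] by simp
  have "(\<Sum>i'\<in>S. a i' *\<^sub>R x i') \<in> C" if "finite S" "S \<subseteq> {..<n}" for S
    using that
  proof (induction S rule: finite_induct)
    case empty
    then show ?case using \<open>0 \<in> C\<close> by simp
  next
    case (insert s S)
    then show ?case
      using cone_add[OF cone_C(1,2)] cone_scaleR[OF cone_C(2) x_mem a0] by simp
  qed
  then have "a i *\<^sub>R x i = (\<phi> \<bullet> (a i *\<^sub>R x i)) *\<^sub>R w"
    using w_extreme[OF _ _ eq] cone_scaleR[OF cone_C(2) x_mem a0] i phi_w by simp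
  then have "a i *\<^sub>R x i = a i *\<^sub>R ((\<phi> \<bullet> x i) *\<^sub>R w)" by simp
  moreover have "a i \<noteq> 0" using nz by (simp add: a_def)
  ultimately show ?thesis using scaleR_left_imp_eq by blast
qed

text \<open>Facets through \<open>w\<close> ignore \<open>y\<close> and the finitely many others are
  positive at \<open>w\<close>, so \<open>w\<close> minus a small multiple of \<open>y\<close> stays
  in \<open>C\<close>; then \<open>w\<close> is split inside the cone.\<close>

lemma vertex_unique:
  assumes y: "y \<in> C" and van: "\<And>b. b \<in> facets_at \<Longrightarrow> b \<bullet> y = 0"
  shows "y = (\<phi> \<bullet> y) *\<^sub>R w"
proof -
  obtain \<epsilon> where e: "\<epsilon> > 0" "\<And>h. h \<in> facets \<Longrightarrow> \<epsilon> * (h \<bullet> y) \<le> h \<bullet> w"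
    using finite_positive_scale[of facets "\<lambda>h. h \<bullet> w" "\<lambda>h. h \<bullet> y"] finite_facets
      facet_nonneg[OF _ w_mem] facet_nonneg[OF _ y] van by (auto simp: facets_at_def)
  have "w - \<epsilon> *\<^sub>R y \<in> C"
    using e by (intro facets_detect) (simp add: inner_diff_right)
  then have "\<epsilon> *\<^sub>R y = (\<phi> \<bullet> (\<epsilon> *\<^sub>R y)) *\<^sub>R w"
    using w_extreme[of "\<epsilon> *\<^sub>R y" "w - \<epsilon> *\<^sub>R y"] cone_scaleR[OF cone_C(2) y] e(1) phi_w by simp
  then have "\<epsilon> *\<^sub>R y = \<epsilon> *\<^sub>R ((\<phi> \<bullet> y) *\<^sub>R w)" by simp
  then show ?thesis using e(1) scaleR_left_imp_eq[of \<epsilon>] by blast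
qed

text \<open>This extends \<open>vertex_unique\<close> to arbitrary \<open>y\<close>. With
  \<open>y\<close> in slot 0 and \<open>w\<close> elsewhere, a term whose \<open>x i\<close> is off
  the ray of \<open>w\<close> dies: some facet through \<open>w\<close> is nonzero at
  \<open>x i\<close>, so it occupies a slot, and it kills both \<open>w\<close> and
  \<open>y\<close>. What remains is a multiple of \<open>w\<close>, and
  \<open>\<psi> = \<phi>\<close> determines the multiple.\<close>

lemma kernel_facets_at:
  assumes van: "\<And>b. b \<in> facets_at \<Longrightarrow> b \<bullet> y = 0"
  shows "y = (\<phi> \<bullet> y) *\<^sub>R w"
proof -
  let ?c = "\<lambda>i. \<Prod>j\<in>{1..<k}. f i j \<bullet> w"
  have key: "(f i 0 \<bullet> y) * ?c i * (\<psi> \<bullet> x i) = (f i 0 \<bullet> y) * ?c i * (\<phi> \<bullet> x i) * (\<psi> \<bullet> w)"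
    if i: "i < n" for i \<psi>
  proof (cases "x i = (\<phi> \<bullet> x i) *\<^sub>R w")
    case True
    then have "\<psi> \<bullet> x i = (\<phi> \<bullet> x i) * (\<psi> \<bullet> w)" by (metis inner_scaleR_right)
    then show ?thesis by simp
  next
    case False
    then obtain b where b: "b \<in> facets_at" "b \<bullet> x i \<noteq> 0"
      using vertex_unique[OF x_mem[OF i]] by blast
    then obtain j where j: "j < k" "f i j = (u \<bullet> f i j) *\<^sub>R b"
      using facet_in_slot[OF i] facets_atD(1) by blast
    have "b \<bullet> w = 0" "b \<bullet> y = 0" using b van facets_atD by auto
    then have "f i j \<bullet> w = 0" "f i j \<bullet> y = 0"
      by (metis inner_scaleR_left mult_zero_right j(2))+
    then have "f i 0 \<bullet> y = 0 \<or> ?c i = 0"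
      using j(1) by (cases "j = 0") auto
    then show ?thesis by auto
  qed
  have "\<psi> \<bullet> y = \<psi> \<bullet> ((\<phi> \<bullet> y) *\<^sub>R w)" for \<psi>
  proof -
    have "\<psi> \<bullet> y + real (k - 1) * ((\<phi> \<bullet> y) * (\<psi> \<bullet> w))
      = real k * (\<Sum>i<n. (f i 0 \<bullet> y) * ?c i * (\<phi> \<bullet> x i) * (\<psi> \<bullet> w))"
      unfolding decomp_slot[OF phi_w] using key by (metis (no_types, lifting) lessThan_iff sum.cong)
    also have "\<dots> = (real k * (\<Sum>i<n. (f i 0 \<bullet> y) * ?c i * (\<phi> \<bullet> x i))) * (\<psi> \<bullet> w)"
      by (simp add: sum_distrib_right)
    also have "\<dots> = (\<phi> \<bullet> y + real (k - 1) * ((\<phi> \<bullet> y) * (\<phi> \<bullet> w))) * (\<psi> \<bullet> w)"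
      unfolding decomp_slot[OF phi_w] ..
    finally show ?thesis by (simp add: phi_w algebra_simps)
  qed
  then show ?thesis using vector_eq_ldot by blast
qed

section \<open>Edges at the vertex and their far ends\<close>

text \<open>This yields linear independence of the facets through \<open>w\<close>. With
  \<open>u\<close> in slot 0, \<open>w\<close> elsewhere and \<open>\<psi> = b\<close>, some term is
  nonzero. A facet through \<open>w\<close> that is nonzero at its \<open>x i\<close> can only sit
  in slot 0, and that slot already belongs to \<open>b\<close>; so \<open>x i\<close> is the vector
  sought.\<close>

lemma edge_direction:
  assumes b: "b \<in> facets_at"
  obtains y where "y \<in> C" "0 < b \<bullet> y" "\<And>b'. b' \<in> facets_at - {b} \<Longrightarrow> b' \<bullet> y = 0"
proof -
  let ?c = "\<lambda>i. \<Prod>j\<in>{1..<k}. f i j \<bullet> w"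
  have "b \<bullet> u = 1" using facet_u facets_atD b by (simp add: inner_commute)
  then have "real k * (\<Sum>i<n. (f i 0 \<bullet> u) * ?c i * (b \<bullet> x i)) \<noteq> 0"
    unfolding decomp_slot[OF phi_w, symmetric] using facets_atD(2)[OF b] by simp
  then have "\<exists>i<n. (f i 0 \<bullet> u) * ?c i * (b \<bullet> x i) \<noteq> 0"
    using sum.neutral[of "{..<n}" "\<lambda>i. (f i 0 \<bullet> u) * ?c i * (b \<bullet> x i)"] by auto
  then obtain i where i: "i < n" "f i 0 \<bullet> u \<noteq> 0" "?c i \<noteq> 0" "b \<bullet> x i \<noteq> 0" by auto
  have slot: "f i 0 = (u \<bullet> f i 0) *\<^sub>R b'" if b': "b' \<in> facets_at" "b' \<bullet> x i \<noteq> 0" for b'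
  proof -
    obtain j where j: "j < k" "f i j = (u \<bullet> f i j) *\<^sub>R b'"
      using facet_in_slot[OF i(1)] facets_atD(1) b' by blast
    then have "f i j \<bullet> w = 0" using facets_atD(2)[OF b'(1)] by (metis inner_scaleR_left mult_zero_right)
    then have "j = 0" using i(3) j(1) by (cases "j = 0") auto
    then show ?thesis using j by simp
  qed
  have "f i 0 \<noteq> 0" using i(2) by auto
  then have "b' \<bullet> x i = 0" if "b' \<in> facets_at - {b}" for b'
    using facet_slot_unique[of b b' "f i 0"] slot[OF b i(4)] slot[of b'] that b facets_atD(1) by blast
  then show ?thesis
    using that[of "x i"] x_mem i facet_nonneg[OF facets_atD(1)[OF b] x_mem[OF i(1)]] by auto
qed

text \<open>The far end of the edge at \<open>w\<close> on which only \<open>b\<close> is nonzero: move from a point of the edge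
  away from \<open>w\<close> until the first facet not containing \<open>w\<close> is hit.\<close>

lemma edge_end:
  assumes b: "b \<in> facets_at"
  obtains z where "z \<in> C" "\<phi> \<bullet> z = 1" "0 < b \<bullet> z"
    "\<And>b'. b' \<in> facets_at - {b} \<Longrightarrow> b' \<bullet> z = 0" "\<exists>h\<in>facets_off. h \<bullet> z = 0"
proof -
  obtain y where y: "y \<in> C" "0 < b \<bullet> y" "\<And>b'. b' \<in> facets_at - {b} \<Longrightarrow> b' \<bullet> y = 0"
    using edge_direction[OF b] by blast
  define s where "s = Min ((\<lambda>h. (h \<bullet> y) / (h \<bullet> w)) ` facets_off)"
  have fin: "finite facets_off" using finite_facets by (auto simp: facets_off_def)
  have s_le: "s \<le> (h \<bullet> y) / (h \<bullet> w)" if "h \<in> facets_off" for h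
    using that fin by (simp add: s_def)
  have "s \<in> (\<lambda>h. (h \<bullet> y) / (h \<bullet> w)) ` facets_off"
    unfolding s_def using fin facets_off_nonempty by (intro Min_in) auto
  then obtain h0 where h0: "h0 \<in> facets_off" "s = (h0 \<bullet> y) / (h0 \<bullet> w)" by blast
  define z where "z = y - s *\<^sub>R w"
  have bz: "b' \<bullet> z = b' \<bullet> y" if "b' \<in> facets_at" for b'
    using that facets_atD(2) by (simp add: z_def inner_diff_right)
  have "z \<in> C"
  proof (rule facets_detect)
    fix h assume h: "h \<in> facets"
    then consider "h \<in> facets_at" | "h \<in> facets_off" using facet_cases by blast
    then show "0 \<le> h \<bullet> z"
    proof cases
      case 1
      then show ?thesis using bz facet_nonneg[OF h y(1)] by simp
    next
      case 2
      then show ?thesis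
        using s_le[OF 2] facets_offD(2)[OF 2] by (simp add: z_def inner_diff_right field_simps)
    qed
  qed
  moreover have "z \<noteq> 0" using bz[OF b] y(2) by auto
  ultimately have pz: "0 < \<phi> \<bullet> z" by (rule phi_pos)
  have h0z: "h0 \<bullet> z = 0" using h0 facets_offD(2) by (fastforce simp: z_def inner_diff_right)
  show ?thesis
  proof (rule that[of "(1 / (\<phi> \<bullet> z)) *\<^sub>R z"])
    show "(1 / (\<phi> \<bullet> z)) *\<^sub>R z \<in> C"
      using \<open>z \<in> C\<close> pz cone_C(2) by (intro cone_scaleR) auto
    show "\<exists>h\<in>facets_off. h \<bullet> (1 / (\<phi> \<bullet> z)) *\<^sub>R z = 0" using h0 h0z by auto
    show "b' \<bullet> (1 / (\<phi> \<bullet> z)) *\<^sub>R z = 0" if "b' \<in> facets_at - {b}" for b'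
      using bz[of b'] y(3)[OF that] that by simp
  qed (use pz bz[OF b] y in auto)
qed

text \<open>The last conjunct makes \<open>z\<close> the endpoint of the edge rather than one of its
  inner points.\<close>

definition far_end :: "'a \<Rightarrow> 'a \<Rightarrow> bool" where
  "far_end b z \<longleftrightarrow> b \<in> facets_at \<and> z \<in> C \<and> \<phi> \<bullet> z = 1 \<and> 0 < b \<bullet> z \<and>
     (\<forall>b'\<in>facets_at - {b}. b' \<bullet> z = 0) \<and> (\<exists>h\<in>facets_off. h \<bullet> z = 0)"

lemma far_end_exists: "b \<in> facets_at \<Longrightarrow> \<exists>z. far_end b z"
  using edge_end[of b] unfolding far_end_def by metis

text \<open>\<open>\<beta>\<close> is chosen to match the value of \<open>b\<close>; the remainder
  is then killed by all facets through \<open>w\<close>, hence a multiple of \<open>w\<close>. A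
  facet through \<open>z\<close> but off \<open>w\<close> shows that this multiple is
  nonnegative.\<close>

lemma edge_points:
  assumes z: "far_end b z" and y: "y \<in> C" "\<And>b'. b' \<in> facets_at - {b} \<Longrightarrow> b' \<bullet> y = 0"
  obtains \<alpha> \<beta> where "0 \<le> \<alpha>" "0 \<le> \<beta>" "y = \<alpha> *\<^sub>R w + \<beta> *\<^sub>R z"
proof -
  define \<beta> where "\<beta> = (b \<bullet> y) / (b \<bullet> z)"
  define \<alpha> where "\<alpha> = \<phi> \<bullet> (y - \<beta> *\<^sub>R z)"
  have "b' \<bullet> (y - \<beta> *\<^sub>R z) = 0" if "b' \<in> facets_at" for b'
    using that z y(2) by (cases "b' = b") (auto simp: far_end_def \<beta>_def inner_diff_right)
  then have "y - \<beta> *\<^sub>R z = \<alpha> *\<^sub>R w" unfolding \<alpha>_def by (rule kernel_facets_at)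
  then have eq: "y = \<alpha> *\<^sub>R w + \<beta> *\<^sub>R z" by (simp add: algebra_simps)
  obtain h where h: "h \<in> facets_off" "h \<bullet> z = 0" using z by (auto simp: far_end_def)
  have "0 \<le> h \<bullet> y" using facet_nonneg facets_offD(1) h(1) y(1) by blast
  then have "0 \<le> \<alpha> * (h \<bullet> w)" by (simp add: eq inner_add_right h)
  then have "0 \<le> \<alpha>" using facets_offD(2)[OF h(1)] by (simp add: zero_le_mult_iff)
  moreover have "0 \<le> \<beta>"
    using z facet_nonneg[OF facets_atD(1) y(1)] by (simp add: far_end_def \<beta>_def)
  ultimately show ?thesis using that eq by blast
qed

text \<open>The decomposition is evaluated at the vector of the edge plane annihilated by \<open>h\<close>: every
  term then contains a vanishing factor, so \<open>\<phi>\<close> vanishes there as well.\<close>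

lemma facet_constant_on_edge:
  assumes z: "far_end b z" and h: "h \<in> facets_off" and hz: "h \<bullet> z \<noteq> 0"
  shows "h \<bullet> z = h \<bullet> w"
proof -
  define v where "v = (h \<bullet> z) *\<^sub>R w - (h \<bullet> w) *\<^sub>R z"
  have hw: "0 < h \<bullet> w" using facets_offD(2)[OF h] .
  have hz': "0 < h \<bullet> z"
    using hz z facet_nonneg[OF facets_offD(1)[OF h]] by (force simp: far_end_def)
  have hv: "h \<bullet> v = 0" by (simp add: v_def inner_diff_right)
  have term_0: "(\<Prod>j<k. f i j \<bullet> v) * (\<psi> \<bullet> x i) = 0" if i: "i < n" for i \<psi>
  proof (cases "x i = 0")
    case False
    have "\<exists>g\<in>facets. g \<bullet> x i \<noteq> 0 \<and> g \<bullet> v = 0"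
    proof (cases "h \<bullet> x i = 0")
      case True
      \<comment> \<open>Otherwise \<open>x i\<close> lies on the edge, where \<open>h\<close> is
        positive at both ends, so \<open>h \<bullet> x i = 0\<close> would force
        \<open>x i = 0\<close>.\<close>
      have "\<exists>b'\<in>facets_at - {b}. b' \<bullet> x i \<noteq> 0"
      proof (rule ccontr)
        assume "\<not> ?thesis"
        then obtain \<alpha> \<beta> where ab: "0 \<le> \<alpha>" "0 \<le> \<beta>" "x i = \<alpha> *\<^sub>R w + \<beta> *\<^sub>R z"
          using edge_points[OF z x_mem[OF i]] by blast
        have "\<alpha> * (h \<bullet> w) + \<beta> * (h \<bullet> z) = 0" using True ab(3) by (simp add: inner_add_right)
        moreover have "0 \<le> \<alpha> * (h \<bullet> w)" "0 \<le> \<beta> * (h \<bullet> z)" using ab hw hz' by auto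
        ultimately have "\<alpha> * (h \<bullet> w) = 0" "\<beta> * (h \<bullet> z) = 0" by linarith+
        then have "\<alpha> = 0" "\<beta> = 0" using hw hz' by auto
        then show False using ab(3) \<open>x i \<noteq> 0\<close> by simp
      qed
      then obtain b' where b': "b' \<in> facets_at - {b}" "b' \<bullet> x i \<noteq> 0" by blast
      then have "b' \<bullet> v = 0"
        using z facets_atD(2) by (simp add: v_def inner_diff_right far_end_def)
      then show ?thesis using b' facets_atD(1) by blast
    next
      case False
      then show ?thesis using h hv facets_offD(1) by blast
    qed
    then obtain g where g: "g \<in> facets" "g \<bullet> x i \<noteq> 0" "g \<bullet> v = 0" by blast
    then obtain j where j: "j < k" "f i j = (u \<bullet> f i j) *\<^sub>R g" using facet_in_slot[OF i] by blast
    then have "f i j \<bullet> v = 0" using g(3) by (metis inner_scaleR_left mult_zero_right)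
    then show ?thesis using j(1) by auto
  qed simp
  have "(\<phi> \<bullet> v) ^ (k - 1) * (\<psi> \<bullet> v) = 0" for \<psi>
    unfolding decomp_diag using term_0 by (intro sum.neutral) auto
  from this[of \<phi>] have "\<phi> \<bullet> v = 0" by auto
  then show ?thesis using z phi_w by (simp add: v_def inner_diff_right far_end_def)
qed

text \<open>The argument of \<open>edge_direction\<close> is repeated at \<open>z\<close>, with
  \<open>w\<close> in slot 0 and \<open>\<psi> = h\<close>. In a nonzero term, every facet through
  \<open>z\<close> that is nonzero at \<open>x i\<close> occupies slot 0. Facets through
  \<open>w\<close> cannot, as that slot is nonzero at \<open>w\<close>; so \<open>x i\<close> lies
  on the edge with a nonzero \<open>w\<close>-component, and \<open>h\<close> and \<open>h'\<close>
  compete for the same slot.\<close>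

lemma far_end_facet_unique:
  assumes z: "far_end b z" and h: "h \<in> facets_off" "h \<bullet> z = 0"
    and h': "h' \<in> facets_off" "h' \<bullet> z = 0"
  shows "h = h'"
proof -
  let ?c = "\<lambda>i. \<Prod>j\<in>{1..<k}. f i j \<bullet> z"
  have pz: "\<phi> \<bullet> z = 1" using z by (simp add: far_end_def)
  have "real k * (\<Sum>i<n. (f i 0 \<bullet> w) * ?c i * (h \<bullet> x i)) \<noteq> 0"
    unfolding decomp_slot[OF pz, symmetric] using facets_offD(2)[OF h(1)] h by simp
  then have "\<exists>i<n. (f i 0 \<bullet> w) * ?c i * (h \<bullet> x i) \<noteq> 0"
    using sum.neutral[of "{..<n}" "\<lambda>i. (f i 0 \<bullet> w) * ?c i * (h \<bullet> x i)"] by auto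
  then obtain i where i: "i < n" "f i 0 \<bullet> w \<noteq> 0" "?c i \<noteq> 0" "h \<bullet> x i \<noteq> 0" by auto
  have c_slot: "j = 0" if "j < k" "f i j \<bullet> z = 0" for j
    using that i(3) by (cases "j = 0") auto
  have slot: "f i 0 = (u \<bullet> f i 0) *\<^sub>R g" if g: "g \<in> facets" "g \<bullet> x i \<noteq> 0" "g \<bullet> z = 0" for g
  proof -
    obtain j where j: "j < k" "f i j = (u \<bullet> f i j) *\<^sub>R g"
      using facet_in_slot[OF i(1)] g by blast
    then have "f i j \<bullet> z = 0" using g(3) by (metis inner_scaleR_left mult_zero_right)
    then show ?thesis using c_slot j by blast
  qed
  have "b' \<bullet> x i = 0" if b': "b' \<in> facets_at - {b}" for b'
  proof (rule ccontr)
    assume "b' \<bullet> x i \<noteq> 0"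
    then have "f i 0 = (u \<bullet> f i 0) *\<^sub>R b'"
      using slot[of b'] b' z facets_atD(1) by (auto simp: far_end_def)
    then have "f i 0 \<bullet> w = 0"
      using facets_atD(2) b' by (metis Diff_iff inner_scaleR_left mult_zero_right)
    then show False using i(2) by simp
  qed
  then obtain \<alpha> \<beta> where ab: "x i = \<alpha> *\<^sub>R w + \<beta> *\<^sub>R z"
    using edge_points[OF z x_mem[OF i(1)]] by blast
  then have "\<alpha> \<noteq> 0" using i(4) h(2) by (auto simp: inner_add_right)
  then have "h' \<bullet> x i \<noteq> 0" using ab h'(2) facets_offD(2)[OF h'(1)] by (simp add: inner_add_right)
  moreover have "f i 0 \<noteq> 0" using i(2) by auto
  ultimately show ?thesis
    using facet_slot_unique[of h h' "f i 0"] slot[of h] slot[of h'] h h' i(4) facets_offD(1) by blast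
qed

section \<open>Assembling the product of simplices\<close>

text \<open>In a term that does not vanish with \<open>w\<close> in all slots, \<open>x i\<close> is
  a nonzero multiple of \<open>w\<close>. Every facet off \<open>w\<close> is nonzero there and so
  needs one of the \<open>k\<close> slots for itself.\<close>

lemma card_facets_off: "card facets_off \<le> k"
proof -
  have "(\<Sum>i<n. (\<Prod>j<k. f i j \<bullet> w) * (\<phi> \<bullet> x i)) \<noteq> 0"
    unfolding decomp_diag[symmetric] using phi_w by simp
  then have "\<exists>i<n. (\<Prod>j<k. f i j \<bullet> w) * (\<phi> \<bullet> x i) \<noteq> 0"
    using sum.neutral[of "{..<n}" "\<lambda>i. (\<Prod>j<k. f i j \<bullet> w) * (\<phi> \<bullet> x i)"] by auto
  then obtain i where i: "i < n" "\<And>j. j < k \<Longrightarrow> f i j \<bullet> w \<noteq> 0" "\<phi> \<bullet> x i \<noteq> 0" by auto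
  have xi: "x i = (\<phi> \<bullet> x i) *\<^sub>R w" using x_parallel_w i by blast
  have "\<exists>j<k. f i j = (u \<bullet> f i j) *\<^sub>R h" if h: "h \<in> facets_off" for h
  proof -
    have "h \<bullet> x i = (\<phi> \<bullet> x i) * (h \<bullet> w)" by (subst xi) simp
    then have "h \<bullet> x i \<noteq> 0" using i(3) facets_offD(2)[OF h] by simp
    then show ?thesis using facet_in_slot[OF i(1)] facets_offD(1)[OF h] by blast
  qed
  then obtain s where s: "\<And>h. h \<in> facets_off \<Longrightarrow> s h < k \<and> f i (s h) = (u \<bullet> f i (s h)) *\<^sub>R h"
    by metis
  have "inj_on s facets_off"
  proof (rule inj_onI)
    fix h h' assume hh: "h \<in> facets_off" "h' \<in> facets_off" "s h = s h'"
    have "f i (s h) \<noteq> 0" using i(2) s[OF hh(1)] by force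
    then show "h = h'"
      using facet_slot_unique[of h h' "f i (s h)"] s[OF hh(1)] s[OF hh(2)] hh facets_offD(1) by simp
  qed
  then have "card facets_off \<le> card {..<k}" using s by (intro card_inj_on_le) auto
  then show ?thesis by simp
qed

text \<open>\<open>w\<close> and the far ends span the space: the combination \<open>s\<close> of
  far ends agrees with \<open>y\<close> on all facets through \<open>w\<close>, so
  \<open>y - s\<close> is a multiple of \<open>w\<close>.\<close>

lemma functional_eqI:
  assumes z: "\<And>b. b \<in> facets_at \<Longrightarrow> far_end b (z b)"
    and "g \<bullet> w = g' \<bullet> w" "\<And>b. b \<in> facets_at \<Longrightarrow> g \<bullet> z b = g' \<bullet> z b"
  shows "g = g'"
proof -
  have fin: "finite facets_at" using finite_facets by (auto simp: facets_at_def)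
  have "g \<bullet> y = g' \<bullet> y" for y
  proof -
    define s where "s = (\<Sum>b\<in>facets_at. ((b \<bullet> y) / (b \<bullet> z b)) *\<^sub>R z b)"
    have "b \<bullet> s = b \<bullet> y" if b: "b \<in> facets_at" for b
    proof -
      have "b \<bullet> z b \<noteq> 0" using z[OF b] by (auto simp: far_end_def)
      then have "b \<bullet> s = (\<Sum>b'\<in>facets_at. if b' = b then b \<bullet> y else 0)"
        unfolding s_def inner_sum_right using z b by (intro sum.cong) (auto simp: far_end_def)
      then show ?thesis using fin b by simp
    qed
    then have "y - s = (\<phi> \<bullet> (y - s)) *\<^sub>R w"
      by (intro kernel_facets_at) (simp add: inner_diff_right)
    moreover have "g \<bullet> s = g' \<bullet> s" using assms(3) by (simp add: s_def inner_sum_right)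
    moreover have "y = (y - s) + s" by simp
    ultimately show ?thesis using assms(2) by (metis inner_add_right inner_scaleR_right)
  qed
  then show ?thesis using vector_eq_rdot by blast
qed

text \<open>There is one factor per facet off \<open>w\<close>, and its dimension is the number of
  edges at \<open>w\<close> ending on that facet.\<close>

lemma simplex_product_base:
  "\<exists>m d. m \<le> k \<and> affinely_isomorphic (C \<inter> {x. \<phi> \<bullet> x = 1}) (simplex_product m d)"
proof -
  have fin: "finite facets_at" "finite facets_off"
    using finite_facets by (auto simp: facets_at_def facets_off_def)
  obtain z where z: "\<And>b. b \<in> facets_at \<Longrightarrow> far_end b (z b)" using far_end_exists by metis
  define m where "m = card facets_off"
  obtain G where G: "bij_betw G {..<m} facets_off"
    using ex_bij_betw_nat_finite[OF fin(2)] by (auto simp: m_def atLeast0LessThan)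
  have G_off: "G l \<in> facets_off" if "l < m" for l using G that by (auto simp: bij_betw_def)
  have "m > 0" using facets_off_nonempty fin by (simp add: m_def card_gt_0_iff)
  \<comment> \<open>Facets through \<open>w\<close> are grouped by the facet on which their edge
    ends; \<open>far_end_facet_unique\<close> makes the classes disjoint.\<close>
  define cls where "cls l = {b \<in> facets_at. G l \<bullet> z b = 0}" for l
  define d where "d l = card (cls l)" for l
  have "\<exists>B. bij_betw B {1..d l} (cls l)" for l
    using ex_bij_betw_nat_finite_1[of "cls l"] fin by (auto simp: d_def cls_def)
  then obtain B where B: "\<And>l. bij_betw (B l) {1..d l} (cls l)" by metis
  have B_cls: "B l j \<in> cls l" if "j \<in> {1..d l}" for l j using bij_betwE[OF B] that by blast
  then have B_at: "B l j \<in> facets_at" if "j \<in> {1..d l}" for l j using that by (auto simp: cls_def)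
  have cls_disjoint: "l = l'" if "b \<in> cls l" "b \<in> cls l'" "l < m" "l' < m" for b l l'
  proof -
    have "G l = G l'"
      using that z[of b] by (intro far_end_facet_unique[of b "z b"] G_off) (auto simp: cls_def)
    then show ?thesis using G that by (auto simp: bij_betw_def inj_on_def)
  qed
  have "\<exists>l j. l < m \<and> j \<in> {1..d l} \<and> B l j = b" if b: "b \<in> facets_at" for b
  proof -
    obtain h where h: "h \<in> facets_off" "h \<bullet> z b = 0" using z[OF b] by (auto simp: far_end_def)
    then obtain l where l: "l < m" "G l = h" using G by (force simp: bij_betw_def)
    then have "b \<in> cls l" using h b by (simp add: cls_def)
    then show ?thesis using B[of l] l by (force simp: bij_betw_def)
  qed
  then obtain L J where LJ: "\<And>b. b \<in> facets_at \<Longrightarrow> L b < m \<and> J b \<in> {1..d (L b)} \<and> B (L b) (J b) = b"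
    by metis
  have LJ_B: "L (B l j) = l \<and> J (B l j) = j" if lj: "l < m" "j \<in> {1..d l}" for l j
  proof -
    have b: "L (B l j) < m" "J (B l j) \<in> {1..d (L (B l j))}" "B (L (B l j)) (J (B l j)) = B l j"
      using LJ[OF B_at[OF lj(2)]] by auto
    then have L: "L (B l j) = l" using cls_disjoint[of "B l j"] B_cls lj by metis
    have "inj_on (B l) {1..d l}" using B bij_betw_def by blast
    then have "J (B l j) = j" by (rule inj_onD) (use b lj L in simp_all)
    then show ?thesis using L by simp
  qed
  \<comment> \<open>Index 0 is reserved for the facet off \<open>w\<close>, scaled to 1 at
    \<open>w\<close>; the facets through \<open>w\<close> take the positive indices, each scaled to
    1 at its own far end.\<close>
  define q where "q l j = (if j = 0 then (1 / (G l \<bullet> w)) *\<^sub>R G l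
    else (1 / (B l j \<bullet> z (B l j))) *\<^sub>R B l j)" for l j
  have split: "{..d l} = insert 0 {1..d l}" for l by auto
  have sum_q: "(\<Sum>j\<le>d l. q l j) = \<phi>" if l: "l < m" for l
  proof -
    have "(\<Sum>j\<in>{1..d l}. q l j) = (\<Sum>j\<in>{1..d l}. (1 / (B l j \<bullet> z (B l j))) *\<^sub>R B l j)"
      by (intro sum.cong) (auto simp: q_def)
    also have "\<dots> = (\<Sum>b\<in>cls l. (1 / (b \<bullet> z b)) *\<^sub>R b)"
      using sum.reindex_bij_betw[OF B[of l], of "\<lambda>b. (1 / (b \<bullet> z b)) *\<^sub>R b"] .
    finally have eq: "(\<Sum>j\<le>d l. q l j) = (1 / (G l \<bullet> w)) *\<^sub>R G l + (\<Sum>b\<in>cls l. (1 / (b \<bullet> z b)) *\<^sub>R b)"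
      unfolding split by (simp add: q_def)
    have Gw: "0 < G l \<bullet> w" using G_off[OF l] facets_offD(2) by blast
    show ?thesis unfolding eq
    proof (rule functional_eqI[OF z])
      have "(\<Sum>b\<in>cls l. (b \<bullet> w) / (b \<bullet> z b)) = 0"
        using facets_atD(2) by (intro sum.neutral) (auto simp: cls_def)
      then show "((1 / (G l \<bullet> w)) *\<^sub>R G l + (\<Sum>b\<in>cls l. (1 / (b \<bullet> z b)) *\<^sub>R b)) \<bullet> w = \<phi> \<bullet> w"
        using Gw phi_w by (simp add: inner_add_left inner_sum_left)
    next
      fix b assume b: "b \<in> facets_at"
      have "(\<Sum>b'\<in>cls l. (b' \<bullet> z b) / (b' \<bullet> z b')) = (\<Sum>b'\<in>cls l. if b' = b then 1 else 0)"
        using z[OF b] by (intro sum.cong) (auto simp: cls_def far_end_def)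
      also have "\<dots> = (if b \<in> cls l then 1 else 0)" using fin by (simp add: cls_def)
      finally have S: "(\<Sum>b'\<in>cls l. (b' \<bullet> z b) / (b' \<bullet> z b')) = (if b \<in> cls l then 1 else 0)" .
      \<comment> \<open>An edge either ends on \<open>G l\<close> or keeps \<open>G l\<close>
        constant. In the first case the coordinate of \<open>b\<close> supplies the missing 1, in
        the second that of \<open>G l\<close> does.\<close>
      have "G l \<bullet> z b = (if b \<in> cls l then 0 else G l \<bullet> w)"
        using facet_constant_on_edge[OF z[OF b] G_off[OF l]] b by (auto simp: cls_def)
      then show "((1 / (G l \<bullet> w)) *\<^sub>R G l + (\<Sum>b\<in>cls l. (1 / (b \<bullet> z b)) *\<^sub>R b)) \<bullet> z b = \<phi> \<bullet> z b"
        using Gw S z[OF b] by (simp add: inner_add_left inner_sum_left far_end_def)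
    qed
  qed
  have q_B: "q l j \<bullet> y = (B l j \<bullet> y) / (B l j \<bullet> z (B l j))" "0 < B l j \<bullet> z (B l j)"
    if "j \<in> {1..d l}" for l j y
    using that z[OF B_at[OF that]] by (auto simp: q_def far_end_def)
  have q_G: "q l 0 \<bullet> y = (G l \<bullet> y) / (G l \<bullet> w)" for l y by (simp add: q_def)
  have "affinely_isomorphic (C \<inter> {x. \<phi> \<bullet> x = 1}) (simplex_product m d)"
  proof (rule affinely_isomorphic_simplex_product[where q = q])
    fix l j assume lj: "l < m" "j \<le> d l"
    show "q l j \<in> dual_cone C"
    proof (cases "j = 0")
      case True
      then show ?thesis
        using facet_nonneg[OF facets_offD(1)[OF G_off[OF lj(1)]]] facets_offD(2)[OF G_off[OF lj(1)]]
        by (simp add: dual_cone_def q_G)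
    next
      case False
      then have j: "j \<in> {1..d l}" using lj by auto
      then show ?thesis
        using facet_nonneg[OF facets_atD(1)[OF B_at[OF j]]] q_B[OF j]
        by (simp add: dual_cone_def)
    qed
  next
    fix y assume nn: "\<And>l j. l < m \<Longrightarrow> j \<le> d l \<Longrightarrow> 0 \<le> q l j \<bullet> y"
    show "y \<in> C"
    proof (rule facets_detect)
      fix h assume "h \<in> facets"
      then consider "h \<in> facets_at" | "h \<in> facets_off" using facet_cases by blast
      then show "0 \<le> h \<bullet> y"
      proof cases
        case 1
        then have "0 \<le> q (L h) (J h) \<bullet> y" using LJ[OF 1] nn by simp
        then show ?thesis using q_B(1)[of "J h" "L h" y] q_B(2)[of "J h" "L h"] LJ[OF 1] by (auto simp: zero_le_divide_iff)
      next
        case 2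
        then obtain l where l: "l < m" "G l = h" using G by (force simp: bij_betw_def)
        then have "0 \<le> q l 0 \<bullet> y" using nn by simp
        then show ?thesis using l facets_offD(2)[OF 2] by (auto simp: q_G zero_le_divide_iff)
      qed
    qed
  next
    fix y assume zero: "\<And>l j. l < m \<Longrightarrow> j \<le> d l \<Longrightarrow> q l j \<bullet> y = 0"
    have "b \<bullet> y = 0" if b: "b \<in> facets_at" for b
      using q_B(1)[of "J b" "L b" y] q_B(2)[of "J b" "L b"] zero[of "L b" "J b"] LJ[OF b] by auto
    then have "y = (\<phi> \<bullet> y) *\<^sub>R w" by (rule kernel_facets_at)
    moreover have "\<phi> \<bullet> y = (\<Sum>j\<le>d 0. q 0 j \<bullet> y)"
      using sum_q[OF \<open>m > 0\<close>] by (metis inner_sum_left)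
    then have "\<phi> \<bullet> y = 0" using zero \<open>m > 0\<close> by simp
    ultimately show "y = 0" by simp
  next
    fix p assume p: "p \<in> simplex_product m d"
    \<comment> \<open>The facets through \<open>w\<close> are, up to scale, dual to the far ends, so
      \<open>y0\<close> has the prescribed values on them. Adding a multiple of \<open>w\<close>
      leaves these unchanged and adjusts \<open>\<phi>\<close> to 1; the coordinates of index 0 then
      follow from the row sums.\<close>
    define y0 where "y0 = (\<Sum>b\<in>facets_at. p (L b) (J b) *\<^sub>R z b)"
    define y where "y = y0 + (1 - \<phi> \<bullet> y0) *\<^sub>R w"
    have py: "\<phi> \<bullet> y = 1" using phi_w by (simp add: y_def inner_add_right)
    have "b \<bullet> y = p (L b) (J b) * (b \<bullet> z b)" if b: "b \<in> facets_at" for b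
    proof -
      have "b \<bullet> y = b \<bullet> y0" using facets_atD(2)[OF b] by (simp add: y_def inner_add_right)
      also have "\<dots> = (\<Sum>b'\<in>facets_at. if b' = b then p (L b) (J b) * (b \<bullet> z b) else 0)"
        unfolding y0_def inner_sum_right using z b by (intro sum.cong) (auto simp: far_end_def)
      finally show ?thesis using fin b by simp
    qed
    then have qB: "q l j \<bullet> y = p l j" if "l < m" "j \<in> {1..d l}" for l j
      using q_B(1)[OF that(2)] q_B(2)[OF that(2)] B_at[OF that(2)] LJ_B[OF that] by simp
    have q0: "q l 0 \<bullet> y = p l 0" if l: "l < m" for l
    proof -
      have "(\<Sum>j\<le>d l. q l j \<bullet> y) = 1" using sum_q[OF l] py by (metis inner_sum_left)
      moreover have "(\<Sum>j\<le>d l. p l j) = 1" using p l by (simp add: simplex_product_def)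
      moreover have "(\<Sum>j\<in>{1..d l}. q l j \<bullet> y) = (\<Sum>j\<in>{1..d l}. p l j)"
        using qB[OF l] by (intro sum.cong) auto
      ultimately show ?thesis unfolding split by simp
    qed
    have "q l j \<bullet> y = p l j" if "l < m" "j \<le> d l" for l j
      using qB[of l j] q0[of l] that by (cases "j = 0") auto
    then show "\<exists>y. \<phi> \<bullet> y = 1 \<and> (\<forall>l<m. \<forall>j\<le>d l. q l j \<bullet> y = p l j)" using py by blast
  qed (rule sum_q)
  then show ?thesis using card_facets_off m_def by blast
qed

end

lemma entanglement_breaking_imp_simplex_product:
  fixes C :: "'a::euclidean_space set"
  assumes proper: "proper_cone C" and phi: "\<phi> \<in> interior (dual_cone C)" and k: "1 \<le> k"
    and eb: "entanglement_breaking C \<phi> k"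
  shows "\<exists>m d. m \<le> k \<and> affinely_isomorphic (C \<inter> {x. \<phi> \<bullet> x = 1}) (simplex_product m d)"
proof -
  have C: "convex C" "cone C" "closed C" using proper by (auto simp: proper_cone_def)
  obtain n :: nat and c f x where dec: "\<forall>i<n. 0 \<le> c i \<and> (\<forall>j<k. f i j \<in> dual_cone C) \<and> x i \<in> C"
    "reduction_tensor k \<phi> = (\<lambda>v \<psi>. \<Sum>i<n. c i * prod_tensor k (f i) (x i) v \<psi>)"
    using eb unfolding entanglement_breaking_def min_tensor_cone_def mem_Collect_eq
    by blast
  obtain u where u: "u \<in> interior C" using proper_cone_interior[OF proper] .
  obtain u' where u': "u' \<in> C" "u' \<noteq> 0"
  proof -
    obtain e :: 'a where "e \<in> Basis" using nonempty_Basis by blast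
    then have "e \<noteq> 0" using nonzero_Basis by blast
    then have "\<not> C \<subseteq> {x. e \<bullet> x = 0}" using proper by (auto simp: proper_cone_def)
    then show ?thesis using that by fastforce
  qed
  have "(1 / (\<phi> \<bullet> u')) *\<^sub>R u' \<in> C \<inter> {x. \<phi> \<bullet> x = 1}"
    using interior_dual_cone_pos[OF phi u'] cone_scaleR[OF C(2) u'(1), of "1 / (\<phi> \<bullet> u')"] by auto
  then obtain w where w: "w extreme_point_of (C \<inter> {x. \<phi> \<bullet> x = 1})"
    using extreme_point_exists_convex[OF compact_cone_base[OF C(3) phi]] C(1)
    by (metis convex_Int convex_hyperplane empty_iff)
  \<comment> \<open>The weights \<open>c i\<close> move into the vectors, which stay in the
    cone.\<close>
  interpret reduction_decomposition C \<phi> k n f "\<lambda>i. c i *\<^sub>R x i" u w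
  proof
    fix v \<psi>
    show "(1 / real k) * (\<Sum>j<k. (\<Prod>i\<in>{..<k} - {j}. \<phi> \<bullet> v i) * (\<psi> \<bullet> v j))
      = (\<Sum>i<n. (\<Prod>j<k. f i j \<bullet> v j) * (\<psi> \<bullet> c i *\<^sub>R x i))"
      using fun_cong[OF fun_cong[OF dec(2)], of v \<psi>]
      by (simp add: reduction_tensor_def prod_tensor_def mult_ac)
    show "c i *\<^sub>R x i \<in> C" if "i < n" for i using dec(1) that C(2) cone_scaleR by blast
  qed (use assms u w dec(1) in auto)
  show ?thesis by (rule simplex_product_base)
qed

section \<open>Products of simplices\<close>

text \<open>A plain sum becomes a convex combination with equal weights \<open>1 / n\<close> once
  the vectors are multiplied by \<open>n\<close>.\<close>

lemma min_tensor_cone_sumI: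
  fixes C :: "'a::euclidean_space set"
  assumes "cone C" "finite I" "I \<noteq> {}"
    and f: "\<And>i j. i \<in> I \<Longrightarrow> j < k \<Longrightarrow> f i j \<in> dual_cone C" and x: "\<And>i. i \<in> I \<Longrightarrow> x i \<in> C"
  shows "(\<lambda>v \<psi>. \<Sum>i\<in>I. prod_tensor k (f i) (x i) v \<psi>) \<in> min_tensor_cone C k"
proof -
  define n where "n = card I"
  have n: "n > 0" using assms by (simp add: n_def card_gt_0_iff)
  obtain h where h: "bij_betw h {..<n} I"
    using ex_bij_betw_nat_finite[OF assms(2)] by (auto simp: n_def atLeast0LessThan)
  have hI: "h i \<in> I" if "i < n" for i using bij_betwE[OF h] that by blast
  let ?c = "\<lambda>i::nat. 1 / real n" and ?x = "\<lambda>i. real n *\<^sub>R x (h i)"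
  have "(\<Sum>i\<in>I. prod_tensor k (f i) (x i) v \<psi>)
      = (\<Sum>i<n. ?c i * prod_tensor k (f (h i)) (?x i) v \<psi>)" for v \<psi>
    using n by (simp add: sum.reindex_bij_betw[OF h, symmetric] prod_tensor_def)
  moreover have "\<forall>i<n. 0 \<le> ?c i \<and> (\<forall>j<k. f (h i) j \<in> dual_cone C) \<and> ?x i \<in> C"
    using f x hI assms(1) by (auto intro: cone_scaleR)
  moreover have "(\<Sum>i<n. ?c i) = 1" using n by simp
  ultimately show ?thesis
    unfolding min_tensor_cone_def mem_Collect_eq
    by (intro exI[of _ n] exI[of _ ?c] exI[of _ "\<lambda>i. f (h i)"] exI[of _ ?x]) auto
qed

text \<open>This is \<open>s - j\<close> modulo \<open>k\<close>, a Latin square all of whose rows are involutions.\<close>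

definition refl_shift :: "nat \<Rightarrow> nat \<Rightarrow> nat \<Rightarrow> nat" where
  "refl_shift k s j = (if j \<le> s then s - j else s + k - j)"

lemma bij_refl_shift: "s < k \<Longrightarrow> bij_betw (refl_shift k s) {..<k} {..<k}"
  by (rule bij_betw_byWitness[where f' = "refl_shift k s"]) (auto simp: refl_shift_def)

lemma refl_shift_involutive: "s < k \<Longrightarrow> j < k \<Longrightarrow> refl_shift k s (refl_shift k s j) = j"
  by (auto simp: refl_shift_def)

lemma bij_refl_shift_left: "i < k \<Longrightarrow> bij_betw (\<lambda>s. refl_shift k s i) {..<k} {..<k}"
  by (rule bij_betw_byWitness[where f' = "\<lambda>t. if t + i < k then t + i else t + i - k"])
    (auto simp: refl_shift_def)

text \<open>The indicator is absorbed into the \<open>i\<close>-th factor before product and sum are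
  exchanged, so that the \<open>i\<close>-th sum collapses to one term.\<close>

lemma sum_PiE_marginal:
  fixes F :: "'i \<Rightarrow> 'j \<Rightarrow> real"
  assumes "finite I" "\<And>i. i \<in> I \<Longrightarrow> finite (D i)" and i: "i \<in> I" "j \<in> D i"
  shows "(\<Sum>c\<in>PiE I D. (\<Prod>i'\<in>I. F i' (c i')) * (if j = c i then 1 else 0))
    = F i j * (\<Prod>i'\<in>I - {i}. \<Sum>l\<in>D i'. F i' l)"
proof -
  define F' where "F' i' l = F i' l * (if i' = i \<and> l \<noteq> j then 0 else 1)" for i' l
  have "(\<Prod>i'\<in>I. F' i' (c i')) = (\<Prod>i'\<in>I. F i' (c i')) * (if j = c i then 1 else 0)" for c
  proof -
    have "(\<Prod>i'\<in>I. if i' = i \<and> c i' \<noteq> j then 0 else 1::real) = (if j = c i then 1 else 0)"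
      using assms(1) i(1) by (auto intro: prod.neutral)
    then show ?thesis by (simp only: F'_def prod.distrib)
  qed
  then have "(\<Sum>c\<in>PiE I D. (\<Prod>i'\<in>I. F i' (c i')) * (if j = c i then 1 else 0))
    = (\<Prod>i'\<in>I. \<Sum>l\<in>D i'. F' i' l)"
    using prod_sum_PiE[OF assms(1,2), where f = F'] by simp
  also have "\<dots> = (\<Sum>l\<in>D i. F' i l) * (\<Prod>i'\<in>I - {i}. \<Sum>l\<in>D i'. F' i' l)"
    using assms(1) i(1) by (rule prod.remove)
  also have "(\<Sum>l\<in>D i. F' i l) = (\<Sum>l\<in>D i. if l = j then F i j else 0)"
    by (intro sum.cong) (auto simp: F'_def)
  also have "\<dots> = F i j" using i assms(2) by simp
  also have "(\<Prod>i'\<in>I - {i}. \<Sum>l\<in>D i'. F' i' l) = (\<Prod>i'\<in>I - {i}. \<Sum>l\<in>D i'. F i' l)"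
    by (intro prod.cong sum.cong) (auto simp: F'_def)
  finally show ?thesis .
qed

text \<open>Measure factor \<open>i\<close> on copy \<open>s - i\<close>, for \<open>s\<close> uniformly random modulo \<open>k\<close>, and prepare the vertex
  given by the outcomes.\<close>

lemma entanglement_breaking_if_coordinates:
  fixes C :: "'a::euclidean_space set" and A :: "nat \<Rightarrow> nat \<Rightarrow> 'a"
  assumes "cone C" and k: "1 \<le> k"
    and dual: "\<And>i j. i < k \<Longrightarrow> j \<le> d i \<Longrightarrow> A i j \<in> dual_cone C"
    and sum_A: "\<And>i. i < k \<Longrightarrow> (\<Sum>j\<le>d i. A i j) = \<phi>"
    and sep: "\<And>y. (\<And>i j. i < k \<Longrightarrow> j \<le> d i \<Longrightarrow> A i j \<bullet> y = 0) \<Longrightarrow> y = 0"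
    and e: "\<And>c. c \<in> PiE {..<k} (\<lambda>i. {..d i}) \<Longrightarrow> e c \<in> C"
      "\<And>c i j. c \<in> PiE {..<k} (\<lambda>i. {..d i}) \<Longrightarrow> i < k \<Longrightarrow> j \<le> d i \<Longrightarrow>
        A i j \<bullet> e c = (if j = c i then 1 else 0)"
  shows "entanglement_breaking C \<phi> k"
proof -
  let ?P = "PiE {..<k} (\<lambda>i. {..d i})"
  let ?I = "{..<k} \<times> ?P"
  let ?f = "\<lambda>(s, c) j. A (refl_shift k s j) (c (refl_shift k s j))"
  let ?x = "\<lambda>(s::nat, c). (1 / real k) *\<^sub>R e c"
  have fin: "finite ?P" by (intro finite_PiE) auto
  \<comment> \<open>Both sides are vectors, compared through the functionals \<open>A i j\<close>,
    which separate points by \<open>sep\<close>.\<close>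
  have vec: "(1 / real k) *\<^sub>R (\<Sum>j<k. (\<Prod>i\<in>{..<k} - {j}. \<phi> \<bullet> v i) *\<^sub>R v j)
    = (\<Sum>(s, c)\<in>?I. (\<Prod>j<k. ?f (s, c) j \<bullet> v j) *\<^sub>R ?x (s, c))" (is "?l = ?r") for v
  proof -
    have "A i j \<bullet> ?r = A i j \<bullet> ?l" if ij: "i < k" "j \<le> d i" for i j
    proof -
      let ?g = "\<lambda>t. (\<Prod>i'\<in>{..<k} - {t}. \<phi> \<bullet> v i') * (A i j \<bullet> v t)"
      \<comment> \<open>For fixed \<open>s\<close>, summing over the outcomes turns every factor but
        \<open>i\<close> into \<open>\<phi>\<close>, while factor \<open>i\<close> is read on copy
        \<open>refl_shift k s i\<close>.\<close>
      have "(\<Sum>c\<in>?P. (\<Prod>j<k. ?f (s, c) j \<bullet> v j) * (A i j \<bullet> e c)) = ?g (refl_shift k s i)"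
        if s: "s < k" for s
      proof -
        let ?\<rho> = "refl_shift k s"
        have \<rho>: "bij_betw ?\<rho> {..<k} {..<k}" using bij_refl_shift[OF s] .
        have pr: "(\<Prod>j<k. ?f (s, c) j \<bullet> v j) = (\<Prod>i'<k. A i' (c i') \<bullet> v (?\<rho> i'))" for c
          using prod.reindex_bij_betw[OF \<rho>, of "\<lambda>i'. A i' (c i') \<bullet> v (?\<rho> i')"]
            refl_shift_involutive[OF s] by simp
        have "(\<Sum>c\<in>?P. (\<Prod>j<k. ?f (s, c) j \<bullet> v j) * (A i j \<bullet> e c))
          = (\<Sum>c\<in>?P. (\<Prod>i'<k. A i' (c i') \<bullet> v (?\<rho> i')) * (if j = c i then 1 else 0))"
          by (intro sum.cong refl) (simp only: pr e(2)[OF _ ij])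
        also have "\<dots> = (A i j \<bullet> v (?\<rho> i)) * (\<Prod>i'\<in>{..<k} - {i}. \<Sum>l\<le>d i'. A i' l \<bullet> v (?\<rho> i'))"
          using ij by (intro sum_PiE_marginal) auto
        also have "(\<Prod>i'\<in>{..<k} - {i}. \<Sum>l\<le>d i'. A i' l \<bullet> v (?\<rho> i'))
          = (\<Prod>i'\<in>{..<k} - {i}. \<phi> \<bullet> v (?\<rho> i'))"
          by (intro prod.cong refl) (simp add: inner_sum_left[symmetric] sum_A)
        also have "\<dots> = (\<Prod>i'\<in>{..<k} - {?\<rho> i}. \<phi> \<bullet> v i')"
        proof (rule prod.reindex_bij_betw)
          show "bij_betw ?\<rho> ({..<k} - {i}) ({..<k} - {?\<rho> i})"
            using bij_betw_DiffI[OF \<rho>, of "{i}" "{?\<rho> i}"] ij \<rho>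
            by (auto simp: bij_betw_def)
        qed
        finally show ?thesis by simp
      qed
      then have "(\<Sum>s<k. \<Sum>c\<in>?P. (\<Prod>j<k. ?f (s, c) j \<bullet> v j) * (A i j \<bullet> e c))
        = (\<Sum>s<k. ?g (refl_shift k s i))" by simp
      \<comment> \<open>As \<open>s\<close> varies, factor \<open>i\<close> visits each copy exactly
        once.\<close>
      also have "\<dots> = (\<Sum>t<k. ?g t)"
        using sum.reindex_bij_betw[OF bij_refl_shift_left[OF ij(1)], of ?g] .
      finally have eq: "(\<Sum>s<k. \<Sum>c\<in>?P. (\<Prod>j<k. ?f (s, c) j \<bullet> v j) * (A i j \<bullet> e c)) = (\<Sum>t<k. ?g t)" .
      have "A i j \<bullet> ?r = (1 / real k) * (\<Sum>s<k. \<Sum>c\<in>?P. (\<Prod>j<k. ?f (s, c) j \<bullet> v j) * (A i j \<bullet> e c))"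
        by (simp add: inner_sum_right sum.cartesian_product sum_distrib_left case_prod_unfold)
      also have "\<dots> = A i j \<bullet> ?l"
        unfolding eq by (simp add: inner_sum_right)
      finally show ?thesis .
    qed
    then have "?r - ?l = 0" by (intro sep) (simp add: inner_diff_right)
    then show ?thesis by simp
  qed
  have "reduction_tensor k \<phi> v \<psi> = (\<Sum>p\<in>?I. prod_tensor k (?f p) (?x p) v \<psi>)" for v \<psi>
  proof -
    have "reduction_tensor k \<phi> v \<psi>
      = \<psi> \<bullet> ((1 / real k) *\<^sub>R (\<Sum>j<k. (\<Prod>i\<in>{..<k} - {j}. \<phi> \<bullet> v i) *\<^sub>R v j))"
      by (simp add: reduction_tensor_def inner_sum_right)
    also have "\<dots> = (\<Sum>p\<in>?I. prod_tensor k (?f p) (?x p) v \<psi>)"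
      unfolding vec by (simp add: inner_sum_right prod_tensor_def case_prod_unfold)
    finally show ?thesis .
  qed
  then have "reduction_tensor k \<phi> = (\<lambda>v \<psi>. \<Sum>p\<in>?I. prod_tensor k (?f p) (?x p) v \<psi>)" by blast
  also have "\<dots> \<in> min_tensor_cone C k"
  proof (rule min_tensor_cone_sumI[OF assms(1)])
    show "finite ?I" using fin by simp
    show "?I \<noteq> {}" using k by (auto simp: PiE_eq_empty_iff lessThan_empty_iff)
    show "?f p j \<in> dual_cone C" if "p \<in> ?I" "j < k" for p j
    proof -
      obtain s c where p: "p = (s, c)" "s < k" "c \<in> ?P" using \<open>p \<in> ?I\<close> by auto
      have i: "refl_shift k s j < k" using p(2) that(2) by (auto simp: refl_shift_def)
      then have "c (refl_shift k s j) \<le> d (refl_shift k s j)"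
        using PiE_mem[OF p(3), of "refl_shift k s j"] by simp
      then show ?thesis using dual[OF i] p(1) by simp
    qed
    show "?x p \<in> C" if "p \<in> ?I" for p
    proof -
      obtain s c where p: "p = (s, c)" "c \<in> ?P" using \<open>p \<in> ?I\<close> by auto
      then show ?thesis using cone_scaleR[OF assms(1) e(1)[OF p(2)]] by simp
    qed
  qed
  finally show ?thesis by (simp add: entanglement_breaking_def)
qed

section \<open>From affine functions on the base to functionals\<close>

text \<open>The homogeneous extension \<open>G\<close> is additive on the cone. Because of the
  interior point \<open>u\<close>, every vector is a difference of two elements of the cone, which
  extends \<open>G\<close> to a linear form.\<close>

lemma affine_on_base_extends:
  fixes C :: "'a::euclidean_space set" and a :: "'a \<Rightarrow> real"
  assumes C: "convex C" "cone C" and u: "u \<in> interior C"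
    and pos: "\<And>x. x \<in> C \<Longrightarrow> x \<noteq> 0 \<Longrightarrow> 0 < \<phi> \<bullet> x"
    and aff: "\<And>x y t. x \<in> C \<inter> {x. \<phi> \<bullet> x = 1} \<Longrightarrow> y \<in> C \<inter> {x. \<phi> \<bullet> x = 1} \<Longrightarrow> 0 \<le> t \<Longrightarrow> t \<le> 1 \<Longrightarrow>
      a (t *\<^sub>R x + (1 - t) *\<^sub>R y) = t * a x + (1 - t) * a y"
  shows "\<exists>g. \<forall>x \<in> C \<inter> {x. \<phi> \<bullet> x = 1}. g \<bullet> x = a x"
proof -
  define G where "G y = (\<phi> \<bullet> y) * a ((1 / (\<phi> \<bullet> y)) *\<^sub>R y)" for y
  have G_scale: "G (c *\<^sub>R y) = c * G y" for c y
    by (cases "c = 0") (auto simp: G_def)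
  have G_add: "G (y + y') = G y + G y'" if y: "y \<in> C" "y' \<in> C" for y y'
  proof (cases "y = 0 \<or> y' = 0")
    case True
    then show ?thesis by (auto simp: G_def)
  next
    case False
    let ?p = "\<phi> \<bullet> y" and ?q = "\<phi> \<bullet> y'"
    have pq: "0 < ?p" "0 < ?q" using False pos y by auto
    \<comment> \<open>The normalised sum is the convex combination of the normalised summands with
      weights proportional to \<open>?p\<close> and \<open>?q\<close>.\<close>
    have "a ((?p / (?p + ?q)) *\<^sub>R ((1 / ?p) *\<^sub>R y) + (1 - ?p / (?p + ?q)) *\<^sub>R ((1 / ?q) *\<^sub>R y'))
      = (?p / (?p + ?q)) * a ((1 / ?p) *\<^sub>R y) + (1 - ?p / (?p + ?q)) * a ((1 / ?q) *\<^sub>R y')"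
      using pq y C(2) by (intro aff) (auto intro!: cone_scaleR simp: field_simps)
    moreover have "1 - ?p / (?p + ?q) = ?q / (?p + ?q)" using pq by (simp add: field_simps)
    ultimately have "a ((1 / (?p + ?q)) *\<^sub>R (y + y'))
      = (?p * a ((1 / ?p) *\<^sub>R y) + ?q * a ((1 / ?q) *\<^sub>R y')) / (?p + ?q)"
      using pq by (simp add: scaleR_add_right add_divide_distrib)
    then show ?thesis using pq by (simp add: G_def inner_add_right)
  qed
  obtain r where r: "r > 0" "cball u r \<subseteq> C" using u mem_interior_cball by blast
  have u_mem: "u \<in> C" using u interior_subset by blast
  \<comment> \<open>For nonzero \<open>y\<close> this makes \<open>(1 / T y) *\<^sub>R y\<close>
    have norm \<open>r\<close>, so adding it to \<open>u\<close> stays in the ball inside the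
    cone.\<close>
  define T where "T y = norm y / r" for y :: 'a
  have T0: "0 \<le> T y" for y using r by (simp add: T_def)
  have T_mem: "y + T y *\<^sub>R u \<in> C" for y
  proof (cases "y = 0")
    case True
    then show ?thesis using cone_scaleR[OF C(2) u_mem, of 0] by (simp add: T_def)
  next
    case False
    then have "T y > 0" using r by (simp add: T_def)
    have "u + (1 / T y) *\<^sub>R y \<in> C"
      using False r by (intro subsetD[OF r(2)]) (simp add: dist_norm T_def)
    then have "T y *\<^sub>R (u + (1 / T y) *\<^sub>R y) \<in> C" using T0 C(2) by (intro cone_scaleR)
    then show ?thesis using \<open>T y > 0\<close> by (simp add: scaleR_add_right add.commute)
  qed
  define L where "L y = G (y + T y *\<^sub>R u) - T y * G u" for y
  \<comment> \<open>The value is independent of the multiple of \<open>u\<close> used; two choices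
    are compared by adding both multiples.\<close>
  have L_eq: "L y = G (y + t *\<^sub>R u) - t * G u" if "0 \<le> t" "y + t *\<^sub>R u \<in> C" for y t
  proof -
    have "G (y + t *\<^sub>R u) + G (T y *\<^sub>R u) = G ((y + t *\<^sub>R u) + T y *\<^sub>R u)"
      using that T0 C u_mem by (intro G_add[symmetric] cone_scaleR) auto
    also have "(y + t *\<^sub>R u) + T y *\<^sub>R u = (y + T y *\<^sub>R u) + t *\<^sub>R u" by simp
    also have "G \<dots> = G (y + T y *\<^sub>R u) + G (t *\<^sub>R u)"
      using that T_mem C u_mem by (intro G_add cone_scaleR) auto
    finally show ?thesis by (simp add: L_def G_scale)
  qed
  have L_add: "L (y + y') = L y + L y'" for y y'
  proof -
    have split: "(y + y') + (T y + T y') *\<^sub>R u = (y + T y *\<^sub>R u) + (y' + T y' *\<^sub>R u)"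
      by (simp add: algebra_simps)
    have "L (y + y') = G ((y + y') + (T y + T y') *\<^sub>R u) - (T y + T y') * G u"
      using T0 cone_add[OF C T_mem T_mem] by (intro L_eq) (auto simp: split)
    then show ?thesis unfolding split using G_add[OF T_mem T_mem] by (simp add: L_def algebra_simps)
  qed
  have L_pos_scale: "L (c *\<^sub>R y) = c * L y" if c: "0 \<le> c" for c y
  proof -
    have split: "c *\<^sub>R y + (c * T y) *\<^sub>R u = c *\<^sub>R (y + T y *\<^sub>R u)" by (simp add: algebra_simps)
    have "L (c *\<^sub>R y) = G (c *\<^sub>R y + (c * T y) *\<^sub>R u) - (c * T y) * G u"
      using c T0 cone_scaleR[OF C(2) T_mem c] by (intro L_eq) (auto simp: split)
    then show ?thesis unfolding split G_scale by (simp add: L_def algebra_simps)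
  qed
  have "L 0 = 0" using L_pos_scale[of 0 0] by simp
  then have L_minus: "L (- y) = - L y" for y using L_add[of y "- y"] by simp
  have "linear L"
  proof (rule linearI)
    fix c y
    show "L (c *\<^sub>R y) = c *\<^sub>R L y"
      using L_pos_scale[of c y] L_pos_scale[of "- c" y] L_minus[of "c *\<^sub>R y"]
      by (cases "0 \<le> c") auto
  qed (rule L_add)
  then have L_inner: "adjoint L 1 \<bullet> y = L y" for y
    using adjoint_works[of L y 1] by (simp add: inner_commute)
  have "L y = a y" if "y \<in> C \<inter> {x. \<phi> \<bullet> x = 1}" for y
    using L_eq[of 0 y] that by (simp add: G_def)
  then show ?thesis using L_inner by (intro exI[of _ "adjoint L 1"]) simp
qed

lemma simplex_product_imp_entanglement_breaking:
  fixes C :: "'a::euclidean_space set"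
  assumes proper: "proper_cone C" and phi: "\<phi> \<in> interior (dual_cone C)" and k: "1 \<le> k"
    and m: "m \<le> k"
    and iso: "affinely_isomorphic (C \<inter> {x. \<phi> \<bullet> x = 1}) (simplex_product m d)"
  shows "entanglement_breaking C \<phi> k"
proof -
  let ?K = "C \<inter> {x. \<phi> \<bullet> x = 1}"
  have C: "convex C" "cone C" "closed C" using proper by (auto simp: proper_cone_def)
  have pos: "0 < \<phi> \<bullet> y" if "y \<in> C" "y \<noteq> 0" for y using interior_dual_cone_pos[OF phi that] .
  obtain u where u: "u \<in> interior C" using proper_cone_interior[OF proper] .
  obtain g where g: "bij_betw g ?K (simplex_product m d)"
    and g_aff: "\<And>x y t. x \<in> ?K \<Longrightarrow> y \<in> ?K \<Longrightarrow> 0 \<le> t \<Longrightarrow> t \<le> 1 \<Longrightarrow>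
      g (t *\<^sub>R x + (1 - t) *\<^sub>R y) = (\<lambda>i j. t * g x i j + (1 - t) * g y i j)"
    using iso unfolding affinely_isomorphic_def by blast
  have "\<exists>b. \<forall>x\<in>?K. b \<bullet> x = g x i j" for i j
    by (rule affine_on_base_extends[OF C(1,2) u pos]) (simp_all add: g_aff)
  then obtain a where a: "\<And>i j x. x \<in> ?K \<Longrightarrow> a i j \<bullet> x = g x i j" by metis
  have g_mem: "g x \<in> simplex_product m d" if "x \<in> ?K" for x using bij_betwE[OF g] that by blast
  \<comment> \<open>The \<open>k - m\<close> missing factors are filled with one-point simplices,
    whose only coordinate is \<open>\<phi>\<close>, equal to 1 on the base.\<close>
  define A where "A i j = (if i < m then a i j else \<phi>)" for i j
  define d' where "d' i = (if i < m then d i else 0)" for i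
  have base: "(1 / (\<phi> \<bullet> y)) *\<^sub>R y \<in> ?K" if "y \<in> C" "y \<noteq> 0" for y
    using pos[OF that] cone_scaleR[OF C(2) that(1), of "1 / (\<phi> \<bullet> y)"] by auto
  have nonneg_dual: "b \<in> dual_cone C" if b: "\<And>x. x \<in> ?K \<Longrightarrow> 0 \<le> b \<bullet> x" for b
    unfolding dual_cone_def
  proof (intro CollectI ballI)
    fix y assume y: "y \<in> C"
    show "0 \<le> b \<bullet> y"
    proof (cases "y = 0")
      case False
      then have "0 \<le> b \<bullet> ((1 / (\<phi> \<bullet> y)) *\<^sub>R y)" using b[OF base[OF y]] by blast
      then show ?thesis using pos[OF y False] by (simp add: zero_le_divide_iff)
    qed simp
  qed
  \<comment> \<open>Otherwise \<open>b - b'\<close> would define a hyperplane containing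
    \<open>C\<close>.\<close>
  have eqI: "b = b'" if b: "\<And>x. x \<in> ?K \<Longrightarrow> b \<bullet> x = b' \<bullet> x" for b b'
  proof -
    have "(b - b') \<bullet> y = 0" if y: "y \<in> C" for y
    proof (cases "y = 0")
      case False
      then show ?thesis
        using b[OF base[OF y]] pos[OF y] by (simp add: inner_diff_left)
    qed simp
    then have "C \<subseteq> {x. (b - b') \<bullet> x = 0}" by blast
    then show ?thesis using proper unfolding proper_cone_def by (metis right_minus_eq)
  qed
  have sum_A: "(\<Sum>j\<le>d' i. A i j) = \<phi>" if "i < k" for i
  proof (rule eqI)
    fix x assume x: "x \<in> ?K"
    show "(\<Sum>j\<le>d' i. A i j) \<bullet> x = \<phi> \<bullet> x"
      using a[OF x] g_mem[OF x] x
      by (cases "i < m") (auto simp: A_def d'_def inner_sum_left simplex_product_def)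
  qed
  \<comment> \<open>The point of the base that corresponds to the vertex \<open>c i\<close> in each
    factor \<open>i\<close>; entries of the padded factors are 0, as membership in
    \<open>simplex_product m d\<close> demands.\<close>
  define e where "e c = inv_into ?K g (\<lambda>i j. if i < m \<and> j = c i then 1 else 0)" for c :: "nat \<Rightarrow> nat"
  have e: "e c \<in> ?K" "g (e c) = (\<lambda>i j. if i < m \<and> j = c i then 1 else 0)"
    if c: "c \<in> PiE {..<k} (\<lambda>i. {..d' i})" for c
  proof -
    have le: "c i \<le> d i" if "i < m" for i
      using PiE_mem[OF c, of i] that m by (simp add: d'_def)
    have "(\<lambda>i j. if i < m \<and> j = c i then 1 else 0) \<in> simplex_product m d"
      by (auto simp: simplex_product_def) (use le leD in blast)+
    then have mem: "(\<lambda>i j. if i < m \<and> j = c i then 1 else 0) \<in> g ` ?K"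
      using g unfolding bij_betw_def by blast
    show "e c \<in> ?K" unfolding e_def using mem by (rule inv_into_into)
    show "g (e c) = (\<lambda>i j. if i < m \<and> j = c i then 1 else 0)"
      unfolding e_def using mem by (rule f_inv_into_f)
  qed
  show ?thesis
  proof (rule entanglement_breaking_if_coordinates[OF C(2) k, where A = A and d = d' and e = e])
    fix i j assume ij: "i < k" "j \<le> d' i"
    show "A i j \<in> dual_cone C"
    proof (rule nonneg_dual)
      fix x assume x: "x \<in> ?K"
      show "0 \<le> A i j \<bullet> x"
        using a[OF x] g_mem[OF x] x ij
        by (cases "i < m") (auto simp: A_def d'_def simplex_product_def)
    qed
  next
    fix y assume zero: "\<And>i j. i < k \<Longrightarrow> j \<le> d' i \<Longrightarrow> A i j \<bullet> y = 0"
    have "\<phi> \<bullet> y = (\<Sum>j\<le>d' 0. A 0 j \<bullet> y)" using sum_A[of 0] k by (simp add: inner_sum_left[symmetric])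
    then have py: "\<phi> \<bullet> y = 0" using zero k by simp
    \<comment> \<open>A nonzero \<open>y\<close> would yield two points of the base with the same
      image under \<open>g\<close>, namely the normalisations of \<open>u\<close> and of
      \<open>u\<close> moved slightly along \<open>y\<close>. As
      \<open>\<phi> \<bullet> y = 0\<close>, the same scalar \<open>s\<close> normalises
      both.\<close>
    show "y = 0"
    proof (rule ccontr)
      assume "y \<noteq> 0"
      obtain r where r: "r > 0" "cball u r \<subseteq> C" using u mem_interior_cball by blast
      have u_mem: "u \<in> C" using u interior_subset by blast
      have mem: "u + (r / norm y) *\<^sub>R y \<in> C"
        using r \<open>y \<noteq> 0\<close> by (intro subsetD[OF r(2)]) (simp add: dist_norm)
      have "u \<noteq> 0"
      proof
        assume "u = 0"
        then have "(r / norm y) *\<^sub>R y \<in> C" using mem by simp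
        then show False using pos[of "(r / norm y) *\<^sub>R y"] py r \<open>y \<noteq> 0\<close> by simp
      qed
      then have pu: "0 < \<phi> \<bullet> u" using pos[OF u_mem] by blast
      define s where "s = 1 / (\<phi> \<bullet> u)"
      have K: "s *\<^sub>R u \<in> ?K" "s *\<^sub>R (u + (r / norm y) *\<^sub>R y) \<in> ?K"
        using cone_scaleR[OF C(2) u_mem, of s] cone_scaleR[OF C(2) mem, of s] pu py
        by (auto simp: s_def inner_add_right)
      have "g (s *\<^sub>R u) i j = g (s *\<^sub>R (u + (r / norm y) *\<^sub>R y)) i j" for i j
      proof (cases "i < m \<and> j \<le> d i")
        case True
        then have "a i j \<bullet> y = 0" using zero[of i j] m by (simp add: A_def d'_def)
        then show ?thesis
          unfolding a[OF K(1), symmetric] a[OF K(2), symmetric] by (simp add: inner_add_right)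
      next
        case False
        then show ?thesis
          using g_mem[OF K(1)] g_mem[OF K(2)] by (auto simp: simplex_product_def not_less not_le)
      qed
      then have "s *\<^sub>R u = s *\<^sub>R (u + (r / norm y) *\<^sub>R y)"
        using g K by (intro inj_onD[of g ?K]) (auto simp: bij_betw_def)
      then show False using pu r \<open>y \<noteq> 0\<close> by (simp add: s_def scaleR_add_right)
    qed
  next
    fix c i j assume c: "c \<in> PiE {..<k} (\<lambda>i. {..d' i})" and ij: "i < k" "j \<le> d' i"
    have "c i \<le> d' i" using PiE_mem[OF c, of i] ij by simp
    then show "A i j \<bullet> e c = (if j = c i then 1 else 0)"
      using a[OF e(1)[OF c], of i j] e[OF c] ij by (cases "i < m") (auto simp: A_def d'_def)
  next
    show "e c \<in> C" if "c \<in> PiE {..<k} (\<lambda>i. {..d' i})" for c using e(1)[OF that] by blast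
  qed (rule sum_A)
qed

theorem theorem2:
  fixes C :: "'a::euclidean_space set" and \<phi> :: 'a and k :: nat
  assumes "proper_cone C"
    and "\<phi> \<in> interior (dual_cone C)"
    and "1 \<le> k"
  shows "entanglement_breaking C \<phi> k \<longleftrightarrow>
    (\<exists>m d. m \<le> k \<and> affinely_isomorphic (C \<inter> {x. \<phi> \<bullet> x = 1}) (simplex_product m d))"
proof
  assume "entanglement_breaking C \<phi> k"
  then show "\<exists>m d. m \<le> k \<and> affinely_isomorphic (C \<inter> {x. \<phi> \<bullet> x = 1}) (simplex_product m d)"
    using entanglement_breaking_imp_simplex_product assms by blast
next
  assume "\<exists>m d. m \<le> k \<and> affinely_isomorphic (C \<inter> {x. \<phi> \<bullet> x = 1}) (simplex_product m d)"
  then show "entanglement_breaking C \<phi> k"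
    using simplex_product_imp_entanglement_breaking assms by blast
qed

end
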